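(* Let $(\mathcal{X},D)$ be a metric space, let $z\in\{1,2\}$, and consider an instance $\mathcal{I}=(X,F,k,m,\mathsf{check},\mathsf{cost})$ of the outlier constrained clustering problem (defined in the context) of size $n$. Let $\mathcal{A}$ be an $\alpha$-approximation algorithm for the corresponding outlier-free constrained clustering problem (same $\mathsf{check}$ and $\mathsf{cost}$, with $m=0$), with running time $T_{\mathcal{A}}(n)$ on inputs of size $n$. Let $\mathcal{C}$ be a constant-factor approximation algorithm for the unconstrained $k$-median problem (if $z=1$) or the unconstrained $k$-means problem (if $z=2$), with running time $T_{\mathcal{C}}(n)$ on inputs of size $n$. Then for every $\varepsilon>0$ there is an $\alpha(1+\varepsilon)$-approximation algorithm for $\mathcal{I}$ with running time $$T_{\mathcal{C}}(n)+q\cdot T_{\mathcal{A}}(n)+O\!\left(n\cdot\left(k+\frac{m^{z+1}\log m}{\varepsilon^z}\right)\right)+O\!\left(q\,m^2(k+m)^3\right),$$ where $q=f(k,m,\varepsilon)=\left(\frac{k+m}{\varepsilon}\right)^{O(m)}$.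
   Context: Let $(\mathcal{X},D)$ be a metric space containing a finite set $X$ of input points and a set $F$ of potential center locations. An instance $\mathcal{I}=(X,F,k,m,\mathsf{check},\mathsf{cost})$ of the outlier constrained clustering problem consists of: a positive integer $k$ (number of clusters); a nonnegative integer $m$ (number of points that may be left out); a function $\mathsf{check}$ that, given a partition $X_0,X_1,\dots,X_k$ of $X$ ($X_0$ being the outliers) and centers $f_1,\dots,f_k\in F$, outputs $1$ (feasible) or $0$, where $\mathsf{check}(X_1,\dots,X_k,f_1,\dots,f_k)$ depends only on the cardinalities $|X_1|,\dots,|X_k|$ and on the locations $f_1,\dots,f_k$; and the cost function $\mathsf{cost}(X_1,\dots,X_k,f_1,\dots,f_k)=\sum_{i=1}^k\sum_{x\in X_i}D^z(x,f_i)$, with $z=1$ (constrained $k$-median) or $z=2$ (constrained $k$-means). The goal is to find a partition $X_0,X_1,\dots,X_k$ of $X$ and centers $f_1,\dots,f_k\in F$ with $|X_0|\le m$ and $\mathsf{check}(X_1,\dots,X_k,f_1,\dots,f_k)=1$ minimizing the cost. The outlier-free version is the same problem with $m=0$. The unconstrained $k'$-median/$k'$-means problem on an instance $(X',F',k')$ asks for $k'$ centers in $F'$ minimizing $\sum_{x\in X'}\min_{c}D^z(x,c)$ (no $\mathsf{check}$ constraint). An $\alpha$-approximation algorithm outputs a feasible solution of cost at most $\alpha$ times the optimum.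
   Formalization: The bound on q is proved as ((k+m)/min(1,ε))^{O(m)}: for ε ≤ 1 it is the stated bound, for ε > 1 it is the bound at ε = 1, since the literal expression drops to 1 or below when ε ≥ k+m and the claim then fails. *)

theory Defs
  imports "HOL-Analysis.Analysis"
begin

section \<open>Machine model\<close>

text \<open>
  A real-RAM style cost model: programs transform immutable pair structures over naturals, reals
  and points of the metric space. Every basic operation, including evaluating the metric on two
  given points, takes one step. \<open>Ext i\<close> invokes the \<open>i\<close>-th external routine of
  an environment \<open>\<rho>\<close>; its result and its cost are both given by \<open>\<rho>\<close>. Statements that
  quantify over all \<open>\<rho>\<close> therefore also cover programs that use coordinates of points, a
  black box for feasibility, or subroutines implemented on another machine.
\<close>

datatype 'p val = VUnit | VNat nat | VReal real | VPt 'p | VPair "'p val" "'p val"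

datatype basic_op =
  Fst | Snd | IsPair | NAdd | NSub | NLess | ToReal | RAdd | RSub | RMul | RDiv | RLess | Dist

fun on_nats :: "(nat \<Rightarrow> nat \<Rightarrow> 'p val) \<Rightarrow> 'p val \<Rightarrow> 'p val" where
  "on_nats f (VPair (VNat a) (VNat b)) = f a b"
| "on_nats f _ = VUnit"

fun on_reals :: "(real \<Rightarrow> real \<Rightarrow> 'p val) \<Rightarrow> 'p val \<Rightarrow> 'p val" where
  "on_reals f (VPair (VReal a) (VReal b)) = f a b"
| "on_reals f _ = VUnit"

fun on_points :: "('p \<Rightarrow> 'p \<Rightarrow> 'p val) \<Rightarrow> 'p val \<Rightarrow> 'p val" where
  "on_points f (VPair (VPt a) (VPt b)) = f a b"
| "on_points f _ = VUnit"

definition VBool :: "bool \<Rightarrow> 'p val" where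
  "VBool b = VNat (if b then 1 else 0)"

fun apply_op :: "basic_op \<Rightarrow> 'p::metric_space val \<Rightarrow> 'p val" where
  "apply_op Fst v = (case v of VPair a b \<Rightarrow> a | _ \<Rightarrow> VUnit)"
| "apply_op Snd v = (case v of VPair a b \<Rightarrow> b | _ \<Rightarrow> VUnit)"
| "apply_op IsPair v = VBool (case v of VPair a b \<Rightarrow> True | _ \<Rightarrow> False)"
| "apply_op NAdd v = on_nats (\<lambda>a b. VNat (a + b)) v"
| "apply_op NSub v = on_nats (\<lambda>a b. VNat (a - b)) v"
| "apply_op NLess v = on_nats (\<lambda>a b. VBool (a < b)) v"
| "apply_op ToReal v = (case v of VNat a \<Rightarrow> VReal (real a) | _ \<Rightarrow> VUnit)"
| "apply_op RAdd v = on_reals (\<lambda>a b. VReal (a + b)) v"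
| "apply_op RSub v = on_reals (\<lambda>a b. VReal (a - b)) v"
| "apply_op RMul v = on_reals (\<lambda>a b. VReal (a * b)) v"
| "apply_op RDiv v = on_reals (\<lambda>a b. VReal (a / b)) v"
| "apply_op RLess v = on_reals (\<lambda>a b. VBool (a < b)) v"
| "apply_op Dist v = on_points (\<lambda>a b. VReal (dist a b)) v"

datatype prog =
    Skip
  | UnitC
  | NatC nat
  | RealC real
  | Op basic_op
  | Ext nat
  | Fork prog prog
  | Seq prog prog
  | If prog prog prog
  | While prog prog

type_synonym 'p env = "nat \<Rightarrow> 'p val \<Rightarrow> 'p val \<times> nat"

text \<open>\<open>exec \<rho> p v w t\<close>: program \<open>p\<close> halts on \<open>v\<close> with result \<open>w\<close> after \<open>t\<close> steps.\<close>

inductive exec :: "'p::metric_space env \<Rightarrow> prog \<Rightarrow> 'p val \<Rightarrow> 'p val \<Rightarrow> nat \<Rightarrow> bool" for \<rho> where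
  Skip: "exec \<rho> Skip v v 1"
| UnitC: "exec \<rho> UnitC v VUnit 1"
| NatC: "exec \<rho> (NatC a) v (VNat a) 1"
| RealC: "exec \<rho> (RealC r) v (VReal r) 1"
| Op: "exec \<rho> (Op f) v (apply_op f v) 1"
| Ext: "exec \<rho> (Ext i) v (fst (\<rho> i v)) (1 + snd (\<rho> i v))"
| Fork: "\<lbrakk>exec \<rho> p v a s; exec \<rho> q v b t\<rbrakk> \<Longrightarrow> exec \<rho> (Fork p q) v (VPair a b) (1 + s + t)"
| Seq: "\<lbrakk>exec \<rho> p v u s; exec \<rho> q u w t\<rbrakk> \<Longrightarrow> exec \<rho> (Seq p q) v w (1 + s + t)"
| IfTrue: "\<lbrakk>exec \<rho> b v g s; g = VBool True; exec \<rho> p v w t\<rbrakk>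
     \<Longrightarrow> exec \<rho> (If b p q) v w (1 + s + t)"
| IfFalse: "\<lbrakk>exec \<rho> b v g s; g \<noteq> VBool True; exec \<rho> q v w t\<rbrakk>
     \<Longrightarrow> exec \<rho> (If b p q) v w (1 + s + t)"
| WhileFalse: "\<lbrakk>exec \<rho> b v g s; g \<noteq> VBool True\<rbrakk> \<Longrightarrow> exec \<rho> (While b p) v v (1 + s)"
| WhileTrue: "\<lbrakk>exec \<rho> b v g s; g = VBool True; exec \<rho> p v u t; exec \<rho> (While b p) u w r\<rbrakk>
     \<Longrightarrow> exec \<rho> (While b p) v w (1 + s + t + r)"

lemma exec_deterministic:
  "exec \<rho> p v w t \<Longrightarrow> exec \<rho> p v w' t' \<Longrightarrow> w' = w \<and> t' = t"
proof (induction arbitrary: w' t' rule: exec.induct)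
  case (Fork p v a s q b t)
  from Fork.prems show ?case by cases (auto dest!: Fork.IH)
next
  case (Seq p v u s q w t)
  from Seq.prems show ?case by cases (metis Seq.IH)
next
  case (IfTrue b v g s p w t q)
  from IfTrue.prems show ?case by cases (use IfTrue.IH IfTrue.hyps in metis)+
next
  case (IfFalse b v g s q w t p)
  from IfFalse.prems show ?case by cases (use IfFalse.IH IfFalse.hyps in metis)+
next
  case (WhileFalse b v g s p)
  from WhileFalse.prems show ?case by cases (use WhileFalse.IH WhileFalse.hyps in metis)+
next
  case (WhileTrue b v g s p u t w r)
  from WhileTrue.prems show ?case by cases (use WhileTrue.IH WhileTrue.hyps in metis)+
qed (auto elim: exec.cases)

fun enc_list :: "('a \<Rightarrow> 'p val) \<Rightarrow> 'a list \<Rightarrow> 'p val" where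
  "enc_list f [] = VUnit"
| "enc_list f (x # xs) = VPair (f x) (enc_list f xs)"

section \<open>Constrained clustering with outliers\<close>

text \<open>
  An algorithm receives the center locations \<open>F\<close> and the function \<open>check\<close> through a
  description \<open>d\<close>. Which descriptions are admissible, and which \<open>F\<close> and \<open>check\<close> they
  denote, is a parameter: \<open>d\<close> may list a finite \<open>F\<close> together with, say, capacities, or merely
  name an infinite \<open>F\<close>. A problem with a single fixed \<open>F\<close> and \<open>check\<close> has one description.
\<close>

record 'p problem =
  descr :: "'p val set"
  locs :: "'p val \<Rightarrow> 'p set"
  check :: "'p val \<Rightarrow> 'p set list \<Rightarrow> 'p list \<Rightarrow> bool"

definition cardinality_based :: "('p set list \<Rightarrow> 'p list \<Rightarrow> bool) \<Rightarrow> bool" where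
  "cardinality_based chk \<longleftrightarrow>
     (\<forall>Xs Ys fs. (\<forall>S\<in>set Xs \<union> set Ys. finite S) \<and> map card Xs = map card Ys
        \<longrightarrow> chk Xs fs = chk Ys fs)"

definition clustering_problem :: "'p problem \<Rightarrow> bool" where
  "clustering_problem P \<longleftrightarrow> (\<forall>d\<in>descr P. cardinality_based (check P d))"

definition is_partition :: "'p set list \<Rightarrow> 'p set \<Rightarrow> bool" where
  "is_partition Xs X \<longleftrightarrow> \<Union> (set Xs) = X \<and>
     (\<forall>i<length Xs. \<forall>j<length Xs. i \<noteq> j \<longrightarrow> Xs ! i \<inter> Xs ! j = {})"

text \<open>Parts may be empty and centers may coincide. \<open>X0\<close> is the set of outliers.\<close>

definition feasible ::
  "'p set \<Rightarrow> 'p set \<Rightarrow> nat \<Rightarrow> nat \<Rightarrow> ('p set list \<Rightarrow> 'p list \<Rightarrow> bool)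
     \<Rightarrow> 'p set \<Rightarrow> 'p set list \<Rightarrow> 'p list \<Rightarrow> bool" where
  "feasible X F k m chk X0 Xs fs \<longleftrightarrow>
     length Xs = k \<and> length fs = k \<and> is_partition (X0 # Xs) X \<and> set fs \<subseteq> F \<and>
     card X0 \<le> m \<and> chk Xs fs"

definition cost :: "nat \<Rightarrow> 'p::metric_space set list \<Rightarrow> 'p list \<Rightarrow> real" where
  "cost z Xs fs = (\<Sum>i<length fs. \<Sum>x\<in>Xs ! i. dist x (fs ! i) ^ z)"

text \<open>For infinite \<open>F\<close> the optimum need not be attained, hence the infimum.\<close>

definition opt ::
  "nat \<Rightarrow> 'p::metric_space set \<Rightarrow> 'p set \<Rightarrow> nat \<Rightarrow> nat
     \<Rightarrow> ('p set list \<Rightarrow> 'p list \<Rightarrow> bool) \<Rightarrow> real" where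
  "opt z X F k m chk = Inf {cost z Xs fs | X0 Xs fs. feasible X F k m chk X0 Xs fs}"

text \<open>
  The parameters \<open>k\<close> and \<open>m\<close> count towards the size: writing down \<open>k\<close> centers alone takes
  \<open>k\<close> steps. An infinite \<open>F\<close> is given implicitly and does not contribute.
\<close>

definition inst_size :: "'p set \<Rightarrow> 'p set \<Rightarrow> nat \<Rightarrow> nat \<Rightarrow> nat" where
  "inst_size X F k m = card (if finite F then X \<union> F else X) + k + m"

definition enc_instance :: "'p list \<Rightarrow> 'p val \<Rightarrow> nat \<Rightarrow> nat \<Rightarrow> 'p val" where
  "enc_instance xs d k m = VPair (enc_list VPt xs) (VPair d (VPair (VNat k) (VNat m)))"

definition enc_solution :: "'p list \<Rightarrow> 'p list list \<Rightarrow> 'p list \<Rightarrow> 'p val" where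
  "enc_solution x0 xss fs =
     VPair (enc_list VPt x0) (VPair (enc_list (enc_list VPt) xss) (enc_list VPt fs))"

text \<open>
  \<open>approx_alg \<rho> P z M \<alpha> p T\<close>: on all instances whose outlier bound \<open>m\<close> lies in \<open>M\<close>, program
  \<open>p\<close> is an \<open>\<alpha>\<close>-approximation algorithm, returning \<open>VUnit\<close> exactly if there is no feasible
  solution. Its running time on instances of size at most \<open>N\<close> is bounded by \<open>T N k m\<close>, where
  the running time consists of reading the input (one step per unit of size) and of the steps of
  the execution.
\<close>

definition approx_alg ::
  "'p::metric_space env \<Rightarrow> 'p problem \<Rightarrow> nat \<Rightarrow> nat set \<Rightarrow> real \<Rightarrow> prog
     \<Rightarrow> (nat \<Rightarrow> nat \<Rightarrow> nat \<Rightarrow> real) \<Rightarrow> bool" where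
  "approx_alg \<rho> P z M \<alpha> p T \<longleftrightarrow>
     (\<forall>d\<in>descr P. \<forall>xs k. \<forall>m\<in>M. distinct xs \<and> 1 \<le> k \<longrightarrow>
        (let X = set xs; F = locs P d; chk = check P d in
         \<exists>out t. exec \<rho> p (enc_instance xs d k m) out t \<and>
           (\<forall>N \<ge> inst_size X F k m. real (inst_size X F k m + t) \<le> T N k m) \<and>
           (if \<exists>X0 Xs fs. feasible X F k m chk X0 Xs fs
            then \<exists>x0 xss fs. out = enc_solution x0 xss fs \<and>
                   distinct x0 \<and> (\<forall>ys\<in>set xss. distinct ys) \<and>
                   feasible X F k m chk (set x0) (map set xss) fs \<and>
                   cost z (map set xss) fs \<le> \<alpha> * opt z X F k m chk
            else out = VUnit)))"

section \<open>Unconstrained clustering\<close>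

definition ucost :: "nat \<Rightarrow> 'p::metric_space set \<Rightarrow> 'p list \<Rightarrow> real" where
  "ucost z X cs = (\<Sum>x\<in>X. Min ((\<lambda>c. dist x c ^ z) ` set cs))"

definition uopt :: "nat \<Rightarrow> 'p::metric_space set \<Rightarrow> 'p set \<Rightarrow> nat \<Rightarrow> real" where
  "uopt z X F k = Inf {ucost z X cs | cs. length cs = k \<and> set cs \<subseteq> F}"

text \<open>Here the candidate centers are always an explicit nonempty list.\<close>

definition unconstrained_approx_alg ::
  "'p::metric_space env \<Rightarrow> nat \<Rightarrow> real \<Rightarrow> prog \<Rightarrow> (nat \<Rightarrow> real) \<Rightarrow> bool" where
  "unconstrained_approx_alg \<rho> z \<beta> p T \<longleftrightarrow>
     (\<forall>xs fs k. distinct xs \<and> distinct fs \<and> fs \<noteq> [] \<and> 1 \<le> k \<longrightarrow>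
        (let X = set xs; F = set fs in
         \<exists>cs t. exec \<rho> p (VPair (enc_list VPt xs) (VPair (enc_list VPt fs) (VNat k)))
                  (enc_list VPt cs) t \<and>
           (\<forall>N \<ge> inst_size X F k 0. real (inst_size X F k 0 + t) \<le> T N) \<and>
           length cs = k \<and> set cs \<subseteq> F \<and>
           ucost z X cs \<le> \<beta> * uopt z X F k))"

end

theory Submission
  imports Defs
begin

text \<open>
  Put \<open>G = k + m + m L\<close> with \<open>L \<ge> 24 / \<epsilon>\<^sup>2\<close>. Farthest-first traversal picks \<open>G\<close> points such that any
  unpicked point at distance \<open>r\<close> from its nearest picked one certifies that the picked points are
  pairwise at distance at least \<open>r\<close>. At most \<open>m\<close> of them are outliers and each center serves at most
  one of them at distance below \<open>r / 2\<close>, so every feasible solution costs at least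
  \<open>m L (r / 2) ^ z\<close>. Performing \<open>m\<close> traversals, each on the points left over by the previous ones,
  yields a pool \<open>R\<close> of \<open>m G\<close> points in which every point outside \<open>R\<close> has \<open>m\<close> such cheap neighbours.
  Hence each outlier outside \<open>R\<close> can be exchanged with its own non-outlier neighbour in \<open>R\<close>; cluster
  sizes are unchanged and the cost grows by a factor of at most \<open>1 + \<epsilon>\<close>. It remains to run the
  outlier-free algorithm once for every set of at most \<open>m\<close> outliers from \<open>R\<close> and to return the best
  solution.
\<close>

section \<open>Exchanging outliers\<close>

text \<open>The outlier-free algorithm can only be run once the outliers have been fixed, and trying
  all small subsets of X would make the number of calls depend on n. The pool makes that number
  depend on k, m and \<epsilon> alone. Trading outliers is compatible with an arbitrary
  \<open>check\<close> because \<open>check\<close> sees only cardinalities and centers: relabelling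
  the clustered points by a bijection, with the centers kept, preserves feasibility.

  A single traversal would give each point one cheap neighbour, but several outliers may share it,
  and it may be an outlier itself. This is why m rounds are made: a neighbour that is already an
  outlier lies in R, so it is itself an outlier that needs no exchange, and enough of the m
  neighbours remain for distinct choices.

  The lower bound on the cost holds for every feasible solution, not just for a cheap one. So the
  optimum need not be guessed, and for an infinite F, where it may not be attained, the infimum is
  taken only at the very end.\<close>

lemma injective_choice:
  assumes "finite A" "\<And>a. a \<in> A \<Longrightarrow> finite (N a) \<and> card A \<le> card (N a)"
  shows "\<exists>f. inj_on f A \<and> (\<forall>a\<in>A. f a \<in> N a)"
  using assms
proof (induction A rule: finite_induct)
  case (insert b A)
  have "\<exists>f. inj_on f A \<and> (\<forall>a\<in>A. f a \<in> N a)"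
    by (rule insert.IH) (use insert.prems insert.hyps in force)
  then obtain f where f: "inj_on f A" "\<forall>a\<in>A. f a \<in> N a" by blast
  \<comment> \<open>Greedy choice: each set of options is at least as large as the whole index set,
    so the values already in use cannot exhaust \<open>N b\<close>.\<close>
  have "card (f ` A) < card (N b)"
    using insert.prems[of b] insert.hyps card_image_le[OF insert.hyps(1), of f] by simp
  then obtain y where y: "y \<in> N b" "y \<notin> f ` A"
    by (meson card_mono finite_imageI insert.hyps(1) not_le subsetI)
  have "inj_on (f(b := y)) (insert b A)"
    using f(1) y(2) insert.hyps(2) by (auto simp: inj_on_def)
  moreover have "\<forall>a\<in>insert b A. (f(b := y)) a \<in> N a"
    using f(2) y(1) insert.hyps(2) by auto
  ultimately show ?case by blast
qed simp

section \<open>Partitions as assignments of points to cluster indices\<close>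

lemma is_partition_imp_assignment:
  assumes "is_partition (X0 # Xs) X" "length Xs = k"
  obtains cl where "\<And>i. i < k \<Longrightarrow> Xs ! i = {x \<in> X - X0. cl x = i}"
    and "\<And>x. x \<in> X - X0 \<Longrightarrow> cl x < k"
proof -
  have U: "X0 \<union> \<Union> (set Xs) = X"
    and D: "\<And>i j. i < Suc k \<Longrightarrow> j < Suc k \<Longrightarrow> i \<noteq> j \<Longrightarrow> (X0 # Xs) ! i \<inter> (X0 # Xs) ! j = {}"
    using assms by (auto simp: is_partition_def)
  have D0: "X0 \<inter> Xs ! i = {}" if "i < k" for i
    using D[of 0 "Suc i"] that by simp
  have D1: "Xs ! i \<inter> Xs ! j = {}" if "i < k" "j < k" "i \<noteq> j" for i j
    using D[of "Suc i" "Suc j"] that by simp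
  have ex: "\<exists>i<k. x \<in> Xs ! i" if "x \<in> X - X0" for x
    using that U assms(2) by (auto simp: in_set_conv_nth)
  define cl where "cl x = (SOME i. i < k \<and> x \<in> Xs ! i)" for x
  have cl: "cl x < k \<and> x \<in> Xs ! cl x" if "x \<in> X - X0" for x
    unfolding cl_def using someI_ex[OF ex[OF that]] by simp
  show thesis
  proof
    fix i assume i: "i < k"
    have "Xs ! i \<subseteq> X" using U i assms(2) nth_mem by blast
    then show "Xs ! i = {x \<in> X - X0. cl x = i}"
      using D0[OF i] cl D1[OF _ i] by blast
  qed (use cl in blast)
qed

text \<open>As one sum over points, the cost can be reindexed along a bijection of points; the
  double sum over clusters cannot.\<close>

lemma cost_assignment:
  assumes "finite W" "length fs = k" "\<And>x. x \<in> W \<Longrightarrow> cl x < k"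
    and "\<And>i. i < k \<Longrightarrow> Xs ! i = {x \<in> W. cl x = i}"
  shows "cost z Xs fs = (\<Sum>x\<in>W. dist x (fs ! cl x) ^ z)"
proof -
  have "cost z Xs fs = (\<Sum>i<k. \<Sum>x | x \<in> W \<and> cl x = i. dist x (fs ! cl x) ^ z)"
    unfolding cost_def assms(2) by (intro sum.cong) (auto simp: assms(4))
  also have "\<dots> = (\<Sum>x\<in>W. dist x (fs ! cl x) ^ z)"
    by (rule sum.group) (use assms in auto)
  finally show ?thesis .
qed

lemma is_partition_assignment:
  assumes "\<And>x. x \<in> W \<Longrightarrow> cl x < k"
  shows "is_partition ({} # map (\<lambda>i. {x \<in> W. cl x = i}) [0..<k]) W"
proof -
  have "({} # map (\<lambda>i. {x \<in> W. cl x = i}) [0..<k]) ! i \<inter> ({} # map (\<lambda>i. {x \<in> W. cl x = i}) [0..<k]) ! j = {}"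
    if "i < Suc k" "j < Suc k" "i \<noteq> j" for i j
    using that by (cases i; cases j) auto
  then show ?thesis using assms by (auto simp: is_partition_def)
qed

lemma cost_nonneg: "0 \<le> cost z Xs fs"
  unfolding cost_def by (intro sum_nonneg) auto

section \<open>Cost lower bound from separated points\<close>

definition separated :: "'p::metric_space set \<Rightarrow> real \<Rightarrow> bool" where
  "separated C r \<longleftrightarrow> (\<forall>a\<in>C. \<forall>b\<in>C. a \<noteq> b \<longrightarrow> r \<le> dist a b)"

lemma separated_cost_bound:
  assumes X: "finite X" and feas: "feasible X F k m chk X0 Xs fs"
    and C: "C \<subseteq> X" "k + m + L \<le> card C" "separated C r" and r: "0 \<le> r"
  shows "real L * (r / 2) ^ z \<le> cost z Xs fs"
proof -
  have len: "length Xs = k" "length fs = k" and part: "is_partition (X0 # Xs) X" and m: "card X0 \<le> m"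
    using feas by (auto simp: feasible_def)
  obtain cl where cl: "\<And>i. i < k \<Longrightarrow> Xs ! i = {x \<in> X - X0. cl x = i}"
    "\<And>x. x \<in> X - X0 \<Longrightarrow> cl x < k"
    using is_partition_imp_assignment[OF part len(1)] by metis
  have X0: "finite X0" using part X by (auto simp: is_partition_def intro: finite_subset)
  have fC: "finite C" using X C(1) finite_subset by blast
  define near where "near = {x \<in> C - X0. dist x (fs ! cl x) < r / 2}"
  have "inj_on cl near"
  proof (rule inj_onI, rule ccontr)
    fix x y assume xy: "x \<in> near" "y \<in> near" "cl x = cl y" "x \<noteq> y"
    have "dist x y \<le> dist x (fs ! cl x) + dist y (fs ! cl x)" by (rule dist_triangle2)
    also have "\<dots> < r" using xy by (auto simp: near_def)
    finally show False using xy C(3) by (fastforce simp: separated_def near_def)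
  qed
  then have "card near = card (cl ` near)" by (simp add: card_image)
  also have "\<dots> \<le> card {..<k}" by (rule card_mono) (use C(1) cl(2) in \<open>auto simp: near_def\<close>)
  finally have near: "card near \<le> k" by simp
  have "card C \<le> card ((C - X0 - near) \<union> near \<union> X0)"
    by (rule card_mono) (use fC X0 in \<open>auto simp: near_def\<close>)
  also have "\<dots> \<le> card (C - X0 - near) + card near + card X0"
    by (meson add_le_mono1 card_Un_le le_trans)
  finally have L: "L \<le> card (C - X0 - near)" using near m C(2) by simp
  have "real L * (r / 2) ^ z \<le> real (card (C - X0 - near)) * (r / 2) ^ z"
    using L r by (intro mult_right_mono) auto
  also have "\<dots> = (\<Sum>x\<in>C - X0 - near. (r / 2) ^ z)" by simp
  also have "\<dots> \<le> (\<Sum>x\<in>C - X0 - near. dist x (fs ! cl x) ^ z)"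
    by (intro sum_mono power_mono) (use r in \<open>auto simp: near_def\<close>)
  also have "\<dots> \<le> (\<Sum>x\<in>X - X0. dist x (fs ! cl x) ^ z)"
    by (rule sum_mono2) (use X C(1) in auto)
  also have "\<dots> = cost z Xs fs"
    by (rule cost_assignment[symmetric]) (use X len cl in auto)
  finally show ?thesis .
qed

text \<open>For z = 2 this is Young's inequality: the mixed term contributes 2 / \<epsilon> and the
  square of r contributes 1, which is at most 1 / \<epsilon>; together 3 / \<epsilon>. For z = 1 the
  same coefficients are more than enough.\<close>

lemma power_add_le_weighted:
  fixes a r \<epsilon> :: real
  assumes "z \<in> {1, 2}" "0 \<le> a" "0 \<le> r" "0 < \<epsilon>" "\<epsilon> \<le> 1"
  shows "(a + r) ^ z \<le> (1 + \<epsilon> / 2) * a ^ z + 3 / \<epsilon> * r ^ z"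
proof (cases "z = 1")
  case True
  have "1 * r \<le> 3 / \<epsilon> * r" using assms by (intro mult_right_mono) (auto simp: field_simps)
  moreover have "0 \<le> \<epsilon> / 2 * a" using assms by simp
  ultimately show ?thesis using True by (simp add: algebra_simps)
next
  case False
  have "0 \<le> (\<epsilon> * a - 2 * r)\<^sup>2 / (2 * \<epsilon>)" using assms by simp
  also have "\<dots> = \<epsilon> / 2 * a\<^sup>2 - 2 * a * r + 2 / \<epsilon> * r\<^sup>2"
    using assms by (simp add: power2_eq_square field_simps)
  finally have "2 * a * r \<le> \<epsilon> / 2 * a\<^sup>2 + 2 / \<epsilon> * r\<^sup>2" by simp
  moreover have "1 * r\<^sup>2 \<le> 1 / \<epsilon> * r\<^sup>2"
    using assms by (intro mult_right_mono) (auto simp: field_simps)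
  ultimately show ?thesis using False assms(1)
    by (simp add: power2_eq_square algebra_simps add_divide_distrib[symmetric])
qed

text \<open>The centers stay fixed. An outlier outside \<open>R\<close> takes over the cluster of
  its partner, which becomes an outlier in its place. Half of \<epsilon> pays for the factor in the
  weighted triangle inequality, the other half for the distances between partners.\<close>

lemma outlier_exchange:
  assumes X: "finite X" and feas: "feasible X F k m chk X0 Xs fs" and chk: "cardinality_based chk"
    and z: "z \<in> {1, 2}" and \<epsilon>: "0 < \<epsilon>" "\<epsilon> \<le> 1" and L: "24 / \<epsilon>\<^sup>2 \<le> real L" and R: "R \<subseteq> X"
    and pool: "\<And>x. x \<in> X - R \<Longrightarrow> \<exists>N\<subseteq>R. m \<le> card N \<and>
      (\<forall>y\<in>N. \<exists>C\<subseteq>X. k + m + m * L \<le> card C \<and> separated C (dist x y))"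
  shows "\<exists>Y Ys. Y \<subseteq> R \<and> card Y \<le> m \<and> feasible (X - Y) F k 0 chk {} Ys fs \<and>
           cost z Ys fs \<le> (1 + \<epsilon>) * cost z Xs fs"
proof -
  have len: "length Xs = k" "length fs = k" and part: "is_partition (X0 # Xs) X" and m: "card X0 \<le> m"
    and F: "set fs \<subseteq> F" and chkXs: "chk Xs fs"
    using feas by (auto simp: feasible_def)
  obtain cl where cl: "\<And>i. i < k \<Longrightarrow> Xs ! i = {x \<in> X - X0. cl x = i}"
    "\<And>x. x \<in> X - X0 \<Longrightarrow> cl x < k"
    using is_partition_imp_assignment[OF part len(1)] by metis
  have X0: "X0 \<subseteq> X" using part by (auto simp: is_partition_def)
  have fin: "finite X0" "finite R" using X X0 R finite_subset by blast+
  obtain N where N: "\<And>x. x \<in> X - R \<Longrightarrow> N x \<subseteq> R \<and> m \<le> card (N x) \<and>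
      (\<forall>y\<in>N x. \<exists>C\<subseteq>X. k + m + m * L \<le> card C \<and> separated C (dist x y))"
    using pool by metis
  \<comment> \<open>Neighbours lost to \<open>X0\<close> lie in \<open>X0 \<inter> R\<close>. Since
    \<open>card X0\<close> is at most \<open>m\<close>, what is left of \<open>N x\<close> is at
    least as large as the set of outliers that need a partner.\<close>
  have "card (X0 - R) \<le> card (N x - X0)" if "x \<in> X0 - R" for x
  proof -
    have x: "N x \<subseteq> R" "m \<le> card (N x)" using N that X0 by auto
    have "card (N x) \<le> card (N x - X0) + card (X0 \<inter> R)"
      using card_mono[of "(N x - X0) \<union> (X0 \<inter> R)" "N x"] x(1) fin finite_subset[OF x(1)]
        card_Un_le[of "N x - X0" "X0 \<inter> R"] by fastforce
    moreover have "card X0 = card (X0 \<inter> R) + card (X0 - R)"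
      by (metis card_Int_Diff fin(1))
    ultimately show ?thesis using x(2) m by linarith
  qed
  moreover have "finite (N x - X0)" if "x \<in> X0 - R" for x
    using N[of x] that X0 fin(2) finite_subset by blast
  ultimately obtain s where s: "inj_on s (X0 - R)" "\<And>x. x \<in> X0 - R \<Longrightarrow> s x \<in> N x - X0"
    using injective_choice[of "X0 - R" "\<lambda>x. N x - X0"] fin by auto
  have sR: "s x \<in> R - X0" if "x \<in> X0 - R" for x
    using s(2)[OF that] N[of x] that X0 by auto
  \<comment> \<open>Outliers inside \<open>R\<close> stay outliers. \<open>h\<close> sends a point
    clustered after the exchange to the point whose place it takes, so the new clustering is the old
    one pulled back along \<open>h\<close>.\<close>
  define Y where "Y = (X0 \<inter> R) \<union> s ` (X0 - R)"
  define h where "h x = (if x \<in> X0 then s x else x)" for x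
  define Ys where "Ys = map (\<lambda>i. {x \<in> X - Y. cl (h x) = i}) [0..<k]"
  have YR: "Y \<subseteq> R" using sR by (auto simp: Y_def)
  have "card Y \<le> card (X0 \<inter> R) + card (X0 - R)"
    unfolding Y_def using card_Un_le card_image_le fin
    by (metis (no_types, lifting) add_left_mono finite_Diff le_trans)
  also have "\<dots> = card X0" by (metis card_Int_Diff fin(1))
  finally have Ym: "card Y \<le> m" using m by simp
  have mem: "x \<in> X0 - R" if "x \<in> X - Y" "x \<in> X0" for x
    using that by (auto simp: Y_def)
  have h: "bij_betw h (X - Y) (X - X0)"
    unfolding bij_betw_def
  proof
    show "inj_on h (X - Y)"
    proof (rule inj_onI)
      fix x y assume *: "x \<in> X - Y" "y \<in> X - Y" "h x = h y"
      show "x = y"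
        using * mem[of x] mem[of y] s(1) by (auto simp: h_def Y_def inj_on_def split: if_splits)
    qed
    show "h ` (X - Y) = X - X0"
    proof (intro equalityI subsetI)
      fix y assume "y \<in> h ` (X - Y)"
      then obtain x where "x \<in> X - Y" "y = h x" by blast
      then show "y \<in> X - X0" using mem[of x] sR[of x] R by (auto simp: h_def split: if_splits)
    next
      fix y assume y: "y \<in> X - X0"
      show "y \<in> h ` (X - Y)"
      proof (cases "y \<in> Y")
        case True
        then obtain x where x: "x \<in> X0 - R" "y = s x" using y by (auto simp: Y_def)
        then have "x \<in> X - Y" "y = h x" using X0 YR by (auto simp: h_def)
        then show ?thesis by blast
      next
        case False
        then have "y \<in> X - Y" "y = h y" using y by (auto simp: h_def)
        then show ?thesis by blast
      qed
    qed
  qed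
  have hcl: "cl (h x) < k" if "x \<in> X - Y" for x
    using cl(2) bij_betwE[OF h] that by blast
  \<comment> \<open>\<open>h\<close> restricts to a bijection on each single cluster, so all cluster
    sizes agree and \<open>cardinality_based\<close> applies.\<close>
  have "bij_betw h {x \<in> X - Y. cl (h x) = i} (Xs ! i)" if "i < k" for i
    unfolding cl(1)[OF that] using h by (auto simp: bij_betw_def inj_on_def)
  then have cards: "map card Xs = map card Ys"
    by (intro nth_equalityI) (auto simp: len Ys_def intro!: bij_betw_same_card[symmetric])
  have "\<forall>S\<in>set Xs \<union> set Ys. finite S"
    using cl(1) X len by (auto simp: Ys_def in_set_conv_nth)
  with chk cards chkXs have "chk Ys fs" unfolding cardinality_based_def by blast
  then have feasY: "feasible (X - Y) F k 0 chk {} Ys fs"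
    using is_partition_assignment[of "X - Y" "\<lambda>x. cl (h x)" k] hcl len F
    by (auto simp: feasible_def Ys_def)
  have cX: "cost z Xs fs = (\<Sum>x\<in>X - X0. dist x (fs ! cl x) ^ z)"
    by (rule cost_assignment) (use X len cl in auto)
  define f where "f x = fs ! cl (h x)" for x
  have cX': "cost z Xs fs = (\<Sum>x\<in>X - Y. dist (h x) (f x) ^ z)"
    unfolding cX f_def by (rule sum.reindex_bij_betw[OF h, symmetric])
  have cY: "cost z Ys fs = (\<Sum>x\<in>X - Y. dist x (f x) ^ z)"
    unfolding f_def by (rule cost_assignment[where k = k]) (use X len hcl in \<open>auto simp: Ys_def\<close>)
  let ?c = "cost z Xs fs"
  \<comment> \<open>Each moved point may use a share 1 / m of the budget. The r ^ z here is at most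
    4 (r / 2) ^ z, as z is at most 2, and m L (r / 2) ^ z is at most \<open>?c\<close>. So the left
    side is at most 12 / (\<epsilon> L) times \<open>?c\<close>, which is at most \<epsilon> / 2
    times \<open>?c\<close> as soon as L is at least 24 / \<epsilon> ^ 2. This is the origin of
    24.\<close>
  have far: "real m * (3 / \<epsilon> * dist x (s x) ^ z) \<le> \<epsilon> / 2 * ?c" if x: "x \<in> X0 - R" for x
  proof -
    obtain C where C: "C \<subseteq> X" "k + m + m * L \<le> card C" "separated C (dist x (s x))"
      using N[of x] s(2)[OF x] x X0 by blast
    have "real (m * L) * (dist x (s x) / 2) ^ z \<le> ?c"
      by (rule separated_cost_bound[OF X feas C]) simp
    moreover have "dist x (s x) ^ z / 4 \<le> (dist x (s x) / 2) ^ z"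
      using z by (auto simp: power_divide)
    ultimately have 1: "real m * real L * (dist x (s x) ^ z / 4) \<le> ?c"
      by (smt (verit) mult_left_mono of_nat_0_le_iff of_nat_mult)
    have "real m * (3 / \<epsilon> * dist x (s x) ^ z) = \<epsilon> / 2 * (24 / \<epsilon>\<^sup>2 * (real m * (dist x (s x) ^ z / 4)))"
      using \<epsilon> by (simp add: power2_eq_square field_simps)
    also have "\<dots> \<le> \<epsilon> / 2 * (real L * (real m * (dist x (s x) ^ z / 4)))"
      using L \<epsilon> by (intro mult_left_mono mult_right_mono) auto
    also have "\<dots> \<le> \<epsilon> / 2 * ?c" using 1 \<epsilon> by (intro mult_left_mono) (auto simp: mult_ac)
    finally show ?thesis .
  qed
  let ?e = "\<lambda>x. if x \<in> X0 then 3 / \<epsilon> * dist x (s x) ^ z else 0"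
  have point: "dist x (f x) ^ z \<le> (1 + \<epsilon> / 2) * dist (h x) (f x) ^ z + ?e x" for x
  proof (cases "x \<in> X0")
    case True
    have "dist x (f x) ^ z \<le> (dist (h x) (f x) + dist x (h x)) ^ z"
      by (rule power_mono) (metis add.commute dist_triangle, simp)
    also have "\<dots> \<le> (1 + \<epsilon> / 2) * dist (h x) (f x) ^ z + 3 / \<epsilon> * dist x (h x) ^ z"
      by (rule power_add_le_weighted) (use z \<epsilon> in auto)
    finally show ?thesis using True by (simp add: h_def)
  next
    case False
    have "1 * dist x (f x) ^ z \<le> (1 + \<epsilon> / 2) * dist x (f x) ^ z"
      using \<epsilon> by (intro mult_right_mono) auto
    then show ?thesis using False by (simp add: h_def)
  qed
  have "(\<Sum>x\<in>X - Y. ?e x) = (\<Sum>x\<in>(X - Y) \<inter> X0. 3 / \<epsilon> * dist x (s x) ^ z)"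
    by (rule sum.inter_restrict[symmetric]) (use X in simp)
  also have "\<dots> \<le> \<epsilon> / 2 * ?c"
  proof (cases "m = 0")
    case True
    then have "X0 = {}" using m fin by simp
    then show ?thesis using \<epsilon> cost_nonneg[of z Xs fs] by simp
  next
    case False
    have "(\<Sum>x\<in>(X - Y) \<inter> X0. 3 / \<epsilon> * dist x (s x) ^ z) \<le> (\<Sum>x\<in>(X - Y) \<inter> X0. \<epsilon> / 2 * ?c / real m)"
      by (rule sum_mono) (use far mem False in \<open>force simp: field_simps\<close>)
    also have "\<dots> = real (card ((X - Y) \<inter> X0)) * (\<epsilon> / 2 * ?c / real m)" by simp
    also have "\<dots> \<le> real m * (\<epsilon> / 2 * ?c / real m)"
      using card_mono[of X0 "(X - Y) \<inter> X0"] fin m \<epsilon> cost_nonneg[of z Xs fs]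
      by (intro mult_right_mono) auto
    finally show ?thesis using False by simp
  qed
  finally have e: "(\<Sum>x\<in>X - Y. ?e x) \<le> \<epsilon> / 2 * ?c" .
  have "cost z Ys fs \<le> (\<Sum>x\<in>X - Y. (1 + \<epsilon> / 2) * dist (h x) (f x) ^ z + ?e x)"
    unfolding cY by (intro sum_mono point)
  also have "\<dots> = (1 + \<epsilon> / 2) * ?c + (\<Sum>x\<in>X - Y. ?e x)"
    unfolding cX' sum.distrib sum_distrib_left ..
  also have "\<dots> \<le> (1 + \<epsilon>) * ?c" using e by (simp add: algebra_simps)
  finally show ?thesis using YR Ym feasY by blast
qed

section \<open>Program logic\<close>

text \<open>An upper bound in place of the exact step count lets rough bounds be composed and
  weakened freely.\<close>

definition runs :: "'p::metric_space env \<Rightarrow> prog \<Rightarrow> 'p val \<Rightarrow> 'p val \<Rightarrow> nat \<Rightarrow> bool" where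
  "runs \<rho> p v w B \<longleftrightarrow> (\<exists>t\<le>B. exec \<rho> p v w t)"

lemma runs_conv: "runs \<rho> p v w B \<Longrightarrow> w = w' \<Longrightarrow> B \<le> B' \<Longrightarrow> runs \<rho> p v w' B'"
  unfolding runs_def using le_trans by blast

lemma runs_Fork:
  "runs \<rho> p v a s \<Longrightarrow> runs \<rho> q v b t \<Longrightarrow> runs \<rho> (Fork p q) v (VPair a b) (1 + s + t)"
  unfolding runs_def by (meson add_le_mono le_refl exec.Fork)

lemma runs_Seq:
  "runs \<rho> p v u s \<Longrightarrow> runs \<rho> q u w t \<Longrightarrow> runs \<rho> (Seq p q) v w (1 + s + t)"
  unfolding runs_def by (meson add_le_mono le_refl exec.Seq)

lemma runs_If:
  assumes "runs \<rho> b v g s"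
    and "g = VBool True \<Longrightarrow> runs \<rho> p v w t" "g \<noteq> VBool True \<Longrightarrow> runs \<rho> q v w t"
  shows "runs \<rho> (If b p q) v w (1 + s + t)"
  using assms unfolding runs_def
  by (cases "g = VBool True") (meson add_le_mono le_refl exec.IfTrue exec.IfFalse)+

lemma runs_While_False:
  "runs \<rho> b v g s \<Longrightarrow> g \<noteq> VBool True \<Longrightarrow> runs \<rho> (While b p) v v (1 + s)"
  unfolding runs_def by (meson add_le_mono le_refl exec.WhileFalse)

lemma runs_While_True:
  "runs \<rho> b v (VBool True) s \<Longrightarrow> runs \<rho> p v u t \<Longrightarrow> runs \<rho> (While b p) u w r
    \<Longrightarrow> runs \<rho> (While b p) v w (1 + s + t + r)"
  unfolding runs_def by (meson add_le_mono le_refl exec.WhileTrue)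

lemma VBool_eq_iff [simp]: "VBool a = VBool b \<longleftrightarrow> a = b" "VUnit \<noteq> VBool a" "VBool a \<noteq> VUnit"
  by (auto simp: VBool_def)

section \<open>Straight-line programs, evaluated by simplification\<close>

fun straight :: "prog \<Rightarrow> bool" where
  "straight (Ext i) = False"
| "straight (While b p) = False"
| "straight (Fork p q) = (straight p \<and> straight q)"
| "straight (Seq p q) = (straight p \<and> straight q)"
| "straight (If b p q) = (straight b \<and> straight p \<and> straight q)"
| "straight _ = True"

fun straight_result :: "prog \<Rightarrow> 'p::metric_space val \<Rightarrow> 'p val" where
  "straight_result UnitC v = VUnit"
| "straight_result (NatC a) v = VNat a"
| "straight_result (RealC r) v = VReal r"
| "straight_result (Op f) v = apply_op f v"
| "straight_result (Fork p q) v = VPair (straight_result p v) (straight_result q v)"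
| "straight_result (Seq p q) v = straight_result q (straight_result p v)"
| "straight_result (If b p q) v =
     (if straight_result b v = VBool True then straight_result p v else straight_result q v)"
| "straight_result _ v = v"

text \<open>Both branches of a conditional are charged, so the bound depends on the program only and
  not on its input.\<close>

fun straight_steps :: "prog \<Rightarrow> nat" where
  "straight_steps (Fork p q) = 1 + straight_steps p + straight_steps q"
| "straight_steps (Seq p q) = 1 + straight_steps p + straight_steps q"
| "straight_steps (If b p q) = 1 + straight_steps b + (straight_steps p + straight_steps q)"
| "straight_steps _ = 1"

lemma runs_straight_result:
  "straight p \<Longrightarrow> runs \<rho> p v (straight_result p v) (straight_steps p)"
proof (induction p arbitrary: v)
  case (Fork p q)
  then show ?case using runs_Fork[of \<rho> p v _ _ q] by simp
next
  case (Seq p q)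
  then show ?case using runs_Seq[of \<rho> p v "straight_result p v" _ q] by simp
next
  case (If b p q)
  then have b: "runs \<rho> b v (straight_result b v) (straight_steps b)"
    and p: "runs \<rho> p v (straight_result p v) (straight_steps p + straight_steps q)"
    and q: "runs \<rho> q v (straight_result q v) (straight_steps p + straight_steps q)"
    using runs_conv by (fastforce intro: runs_conv)+
  show ?case
    using runs_If[OF b, of p "straight_result (If b p q) v" "straight_steps p + straight_steps q" q] p q
    by auto
qed (auto simp: runs_def intro!: exI[of _ "Suc 0"] exec.Skip[simplified] exec.UnitC[simplified]
    exec.NatC[simplified] exec.RealC[simplified] exec.Op[simplified])

lemma runs_straight:
  "straight p \<Longrightarrow> straight_result p v = w \<Longrightarrow> straight_steps p \<le> B \<Longrightarrow> runs \<rho> p v w B"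
  using runs_straight_result runs_conv by blast

abbreviation fst_of :: "prog \<Rightarrow> prog" where "fst_of p \<equiv> Seq p (Op Fst)"
abbreviation snd_of :: "prog \<Rightarrow> prog" where "snd_of p \<equiv> Seq p (Op Snd)"
abbreviation op2 :: "basic_op \<Rightarrow> prog \<Rightarrow> prog \<Rightarrow> prog" where "op2 f p q \<equiv> Seq (Fork p q) (Op f)"

text \<open>On a right-nested tuple, \<open>argN\<close> selects component N counted from 0, and
  \<open>tailN\<close> is what follows the first N components.\<close>

abbreviation "arg0 \<equiv> Op Fst"
abbreviation "tail1 \<equiv> Op Snd"
abbreviation "arg1 \<equiv> fst_of tail1"
abbreviation "tail2 \<equiv> snd_of tail1"
abbreviation "arg2 \<equiv> fst_of tail2"
abbreviation "tail3 \<equiv> snd_of tail2"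

section \<open>Loops over lists and counters\<close>

definition fold_prog :: "prog \<Rightarrow> prog" where
  "fold_prog p =
     snd_of (While (Seq arg0 (Op IsPair))
       (Fork (snd_of arg0) (Seq (Fork (fst_of arg0) tail1) p)))"

text \<open>The loop state pairs the unread suffix with an accumulator; since \<open>VUnit\<close>
  encodes the empty list, \<open>IsPair\<close> is the loop test. The invariant speaks of the prefix
  already read, and the accumulator is existential because some later invariants determine it only
  partially. The overhead of a round is rounded up into the factor 15.\<close>

lemma runs_fold_prog:
  assumes init: "I [] a"
    and step: "\<And>ys x zs a. xs = ys @ x # zs \<Longrightarrow> I ys a \<Longrightarrow>
                 \<exists>a'. runs \<rho> p (VPair (e x) a) a' B \<and> I (ys @ [x]) a'"
  shows "\<exists>a'. runs \<rho> (fold_prog p) (VPair (enc_list e xs) a) a' (15 * (B + 1) * (length xs + 1)) \<and> I xs a'"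
proof -
  let ?b = "Seq arg0 (Op IsPair)"
  let ?c = "Fork (snd_of arg0) (Seq (Fork (fst_of arg0) tail1) p)"
  have "\<exists>a'. runs \<rho> (While ?b ?c) (VPair (enc_list e zs) a) (VPair VUnit a')
           ((15 + B) * length zs + 4) \<and> I xs a'"
    if "xs = ys @ zs" "I ys a" for ys zs a
    using that
  proof (induction zs arbitrary: ys a)
    case Nil
    have "runs \<rho> ?b (VPair VUnit a) (VBool False) 3"
      by (rule runs_straight) simp_all
    from runs_While_False[OF this, of ?c] Nil show ?case by auto
  next
    case (Cons x zs)
    from step[OF Cons.prems] obtain a'
      where a': "runs \<rho> p (VPair (e x) a) a' B" "I (ys @ [x]) a'" by blast
    have b: "runs \<rho> ?b (VPair (enc_list e (x # zs)) a) (VBool True) 3"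
      by (rule runs_straight) simp_all
    have "runs \<rho> (Fork (fst_of arg0) tail1) (VPair (enc_list e (x # zs)) a) (VPair (e x) a) 5"
      by (rule runs_straight) simp_all
    from runs_Seq[OF this a'(1)]
    have 1: "runs \<rho> (Seq (Fork (fst_of arg0) tail1) p) (VPair (enc_list e (x # zs)) a) a' (1 + 5 + B)" .
    have "runs \<rho> (snd_of arg0) (VPair (enc_list e (x # zs)) a) (enc_list e zs) 3"
      by (rule runs_straight) simp_all
    from runs_Fork[OF this 1]
    have c: "runs \<rho> ?c (VPair (enc_list e (x # zs)) a) (VPair (enc_list e zs) a') (1 + 3 + (1 + 5 + B))" .
    from Cons.IH[of "ys @ [x]" a'] a'(2) Cons.prems(1) obtain a''
      where a'': "runs \<rho> (While ?b ?c) (VPair (enc_list e zs) a') (VPair VUnit a'')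
           ((15 + B) * length zs + 4)" "I xs a''" by auto
    show ?case
      by (intro exI conjI, rule runs_conv[OF runs_While_True[OF b c a''(1)]])
        (use a''(2) in auto)
  qed
  from this[of "[]" xs a] init obtain a'
    where 1: "runs \<rho> (While ?b ?c) (VPair (enc_list e xs) a) (VPair VUnit a') ((15 + B) * length xs + 4)"
      and I: "I xs a'" by auto
  have 2: "runs \<rho> tail1 (VPair VUnit a') a' 1"
    by (rule runs_straight) simp_all
  show ?thesis
    using runs_conv[OF runs_Seq[OF 1 2] refl, of "15 * (B + 1) * (length xs + 1)"] I
    by (auto simp: fold_prog_def algebra_simps)
qed

definition repeat_prog :: "prog \<Rightarrow> prog" where
  "repeat_prog p =
     snd_of (While (op2 NLess (NatC 0) arg0) (Fork (op2 NSub arg0 (NatC 1)) (Seq tail1 p)))"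

lemma runs_repeat_prog:
  assumes init: "I 0 a"
    and step: "\<And>i a. i < n \<Longrightarrow> I i a \<Longrightarrow> \<exists>a'. runs \<rho> p a a' B \<and> I (Suc i) a'"
  shows "\<exists>a'. runs \<rho> (repeat_prog p) (VPair (VNat n) a) a' (15 * (B + 1) * (n + 1)) \<and> I n a'"
proof -
  let ?b = "op2 NLess (NatC 0) arg0"
  let ?c = "Fork (op2 NSub arg0 (NatC 1)) (Seq tail1 p)"
  \<comment> \<open>The machine counts down while the invariant counts up: \<open>j\<close> is the
    stored counter, \<open>i\<close> the number of completed rounds.\<close>
  have "\<exists>a'. runs \<rho> (While ?b ?c) (VPair (VNat j) a) (VPair (VNat 0) a')
           ((15 + B) * j + 6) \<and> I n a'"
    if "n = i + j" "I i a" for i j a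
    using that
  proof (induction j arbitrary: i a)
    case 0
    have "runs \<rho> ?b (VPair (VNat 0) a) (VBool False) 5"
      by (rule runs_straight) simp_all
    from runs_While_False[OF this, of ?c] 0 show ?case by auto
  next
    case (Suc j)
    then obtain a' where a': "runs \<rho> p a a' B" "I (Suc i) a'" using step[of i a] by auto
    have b: "runs \<rho> ?b (VPair (VNat (Suc j)) a) (VBool True) 5"
      by (rule runs_straight) simp_all
    have "runs \<rho> tail1 (VPair (VNat (Suc j)) a) a 1"
      by (rule runs_straight) simp_all
    from runs_Seq[OF this a'(1)]
    have 1: "runs \<rho> (Seq tail1 p) (VPair (VNat (Suc j)) a) a' (1 + 1 + B)" .
    have "runs \<rho> (op2 NSub arg0 (NatC 1)) (VPair (VNat (Suc j)) a) (VNat j) 5"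
      by (rule runs_straight) simp_all
    from runs_Fork[OF this 1]
    have c: "runs \<rho> ?c (VPair (VNat (Suc j)) a) (VPair (VNat j) a') (1 + 5 + (1 + 1 + B))" .
    from Suc.IH[of "Suc i" a'] a'(2) Suc.prems(1) obtain a''
      where a'': "runs \<rho> (While ?b ?c) (VPair (VNat j) a') (VPair (VNat 0) a'') ((15 + B) * j + 6)"
        "I n a''" by auto
    show ?case
      by (intro exI conjI, rule runs_conv[OF runs_While_True[OF b c a''(1)]])
        (use a''(2) in auto)
  qed
  from this[of 0 n a] init obtain a'
    where 1: "runs \<rho> (While ?b ?c) (VPair (VNat n) a) (VPair (VNat 0) a') ((15 + B) * n + 6)"
      and I: "I n a'" by auto
  have 2: "runs \<rho> tail1 (VPair (VNat 0) a') a' 1"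
    by (rule runs_straight) simp_all
  show ?thesis
    using runs_conv[OF runs_Seq[OF 1 2] refl, of "15 * (B + 1) * (n + 1)"] I
    by (auto simp: repeat_prog_def algebra_simps)
qed

lemma runs_fold_prog_fun:
  assumes "\<And>ys x zs. xs = ys @ x # zs \<Longrightarrow> runs \<rho> p (VPair (e x) (g ys)) (g (ys @ [x])) B"
  shows "runs \<rho> (fold_prog p) (VPair (enc_list e xs) (g [])) (g xs) (15 * (B + 1) * (length xs + 1))"
  using runs_fold_prog[of "\<lambda>ys a. a = g ys" "g []" xs \<rho> p e B] assms by auto

section \<open>Programs\<close>

abbreviation enc_pts :: "'p list \<Rightarrow> 'p val" where "enc_pts \<equiv> enc_list VPt"

text \<open>One format for three roles: unpicked points with the picks of a traversal, leftover
  points with the pool, and clustered points with guessed outliers. In each case a point moves from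
  the first list to the second.\<close>

definition enc_cand :: "'p list \<times> 'p list \<Rightarrow> 'p val" where
  "enc_cand c = VPair (enc_pts (fst c)) (enc_pts (snd c))"

text \<open>The reversals record that a fold pushes points onto the front of a list. On a distinct
  list at most one point is moved, and none if \<open>y\<close> has been moved before.\<close>

definition remove_pt :: "'p \<Rightarrow> 'p list \<times> 'p list \<Rightarrow> 'p list \<times> 'p list" where
  "remove_pt y c = (rev (filter (\<lambda>x. x \<noteq> y) (fst c)), rev (filter (\<lambda>x. x = y) (fst c)) @ snd c)"

text \<open>The machine has no equality test on points; in a metric space, positive distance serves
  as the test for being different.\<close>

definition remove_step :: prog where
  "remove_step =
     Fork arg1 (If (op2 RLess (RealC 0) (op2 Dist arg0 arg1))
       (Fork (Fork arg0 arg2) tail3) (Fork arg2 (Fork arg0 tail3)))"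

definition remove_prog :: prog where
  "remove_prog =
     snd_of (Seq (Fork arg1 (Fork arg0 (Fork UnitC tail2))) (fold_prog remove_step))"

text \<open>Here, as in the bounds below, the constant is a rounded-up value: the fold contributes
  15 * 61, and the rest covers the rearrangement of arguments.\<close>

lemma runs_remove_prog:
  "runs \<rho> remove_prog (VPair (VPt y) (enc_cand c)) (enc_cand (remove_pt y c)) (1000 * (length (fst c) + 1))"
proof -
  let ?g = "\<lambda>ys. VPair (VPt y) (enc_cand (remove_pt y (ys, snd c)))"
  have 1: "runs \<rho> (Fork arg1 (Fork arg0 (Fork UnitC tail2))) (VPair (VPt y) (enc_cand c))
      (VPair (enc_pts (fst c)) (?g [])) 20"
    by (rule runs_straight) (simp_all add: enc_cand_def remove_pt_def)
  have 2: "runs \<rho> (fold_prog remove_step) (VPair (enc_pts (fst c)) (?g [])) (?g (fst c))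
      (15 * (60 + 1) * (length (fst c) + 1))"
    by (rule runs_fold_prog_fun, rule runs_straight)
      (auto simp: remove_step_def enc_cand_def remove_pt_def)
  have 3: "runs \<rho> tail1 (?g (fst c)) (enc_cand (remove_pt y c)) 1"
    by (rule runs_straight) simp_all
  show ?thesis
    unfolding remove_prog_def by (rule runs_conv[OF runs_Seq[OF runs_Seq[OF 1 2] 3]]) auto
qed

text \<open>\<open>VUnit\<close> plays the role of infinity: comparing it with anything by \<open>RLess\<close> never yields true.\<close>

definition dist_val :: "'p::metric_space \<Rightarrow> 'p list \<Rightarrow> 'p val" where
  "dist_val x cs = (if cs = [] then VUnit else VReal (Min (dist x ` set cs)))"

definition nearest_step :: prog where
  "nearest_step =
     Fork arg1 (If (op2 RLess tail2 (op2 Dist arg1 arg0)) tail2 (op2 Dist arg1 arg0))"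

definition nearest_prog :: prog where
  "nearest_prog = snd_of (Seq (Fork tail1 (Fork arg0 UnitC)) (fold_prog nearest_step))"

lemma runs_nearest_prog:
  "runs \<rho> nearest_prog (VPair (VPt x) (enc_pts cs)) (dist_val x cs) (700 * (length cs + 1))"
proof -
  let ?g = "\<lambda>ys. VPair (VPt x) (dist_val x ys)"
  have 1: "runs \<rho> (Fork tail1 (Fork arg0 UnitC)) (VPair (VPt x) (enc_pts cs))
      (VPair (enc_pts cs) (?g [])) 20"
    by (rule runs_straight) (simp_all add: dist_val_def)
  have 2: "runs \<rho> (fold_prog nearest_step) (VPair (enc_pts cs) (?g [])) (?g cs)
      (15 * (40 + 1) * (length cs + 1))"
  proof (rule runs_fold_prog_fun)
    fix ys c zs
    show "runs \<rho> nearest_step (VPair (VPt c) (?g ys)) (?g (ys @ [c])) 40"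
    proof (cases "ys = []")
      case True
      show ?thesis by (rule runs_straight) (simp_all add: nearest_step_def dist_val_def True)
    next
      case False
      define M where "M = Min (dist x ` set ys)"
      have "Min (dist x ` set (ys @ [c])) = min (dist x c) M" using False by (simp add: M_def)
      then have "dist_val x ys = VReal M"
        "dist_val x (ys @ [c]) = VReal (if M < dist x c then M else dist x c)"
        using False by (auto simp: dist_val_def M_def[symmetric] min_def)
      then show ?thesis by (intro runs_straight) (simp_all add: nearest_step_def)
    qed
  qed
  have 3: "runs \<rho> tail1 (?g cs) (dist_val x cs) 1"
    by (rule runs_straight) simp_all
  show ?thesis
    unfolding nearest_prog_def by (rule runs_conv[OF runs_Seq[OF runs_Seq[OF 1 2] 3]]) auto
qed

section \<open>Farthest-first traversal\<close>

definition farthest_step :: prog where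
  "farthest_step =
     Fork arg1 (If (op2 RLess (Seq (Fork tail2 arg1) nearest_prog) (Seq (Fork arg0 arg1) nearest_prog))
       arg0 tail2)"

definition farthest_prog :: prog where
  "farthest_prog = snd_of (Seq (Fork arg0 (Fork tail1 (fst_of arg0))) (fold_prog farthest_step))"

text \<open>Maximality of the distance to \<open>cs\<close> is phrased through all lower bounds
  \<open>r\<close>. This avoids \<open>Min\<close>, makes sense for empty \<open>cs\<close>, and is
  the form in which separation is propagated.\<close>

lemma runs_farthest_prog:
  assumes "rest \<noteq> []"
  shows "\<exists>p\<in>set rest. runs \<rho> farthest_prog (enc_cand (rest, cs)) (VPt p)
      (23000 * ((length cs + 1) * (length rest + 1))) \<and>
    (\<forall>x\<in>set rest. \<forall>r. (\<forall>c\<in>set cs. r \<le> dist x c) \<longrightarrow> (\<forall>c\<in>set cs. r \<le> dist p c))"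
proof -
  let ?far = "\<lambda>x b. \<forall>r. (\<forall>c\<in>set cs. r \<le> dist x c) \<longrightarrow> (\<forall>c\<in>set cs. r \<le> dist b c)"
  let ?I = "\<lambda>ys a. \<exists>b\<in>set rest. a = VPair (enc_pts cs) (VPt b) \<and> (\<forall>x\<in>set ys. ?far x b)"
  let ?B = "1500 * (length cs + 1)"
  have Min: "?far x b" if "cs \<noteq> [] \<longrightarrow> Min (dist x ` set cs) \<le> Min (dist b ` set cs)" for x b
  proof (intro allI impI ballI)
    fix r c assume r: "\<forall>c\<in>set cs. r \<le> dist x c" and c: "c \<in> set cs"
    have "r \<le> Min (dist x ` set cs)" using r c by (subst Min_ge_iff) auto
    also have "\<dots> \<le> Min (dist b ` set cs)" using that c by (metis empty_iff list.set(1))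
    also have "\<dots> \<le> dist b c" using c by simp
    finally show "r \<le> dist b c" .
  qed
  have 1: "runs \<rho> (Fork arg0 (Fork tail1 (fst_of arg0))) (enc_cand (rest, cs))
      (VPair (enc_pts rest) (VPair (enc_pts cs) (VPt (hd rest)))) 20"
    by (rule runs_straight) (use assms in \<open>cases rest; simp add: enc_cand_def\<close>)+
  have "\<exists>a'. runs \<rho> (fold_prog farthest_step) (VPair (enc_pts rest) (VPair (enc_pts cs) (VPt (hd rest)))) a'
      (15 * (?B + 1) * (length rest + 1)) \<and> ?I rest a'"
  proof (rule runs_fold_prog[where I = ?I])
    show "?I [] (VPair (enc_pts cs) (VPt (hd rest)))" using assms by auto
  next
    fix ys x zs a assume xs: "rest = ys @ x # zs" and "?I ys a"
    then obtain b where b: "b \<in> set rest" "a = VPair (enc_pts cs) (VPt b)" "\<forall>x\<in>set ys. ?far x b" by auto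
    let ?v = "VPair (VPt x) a"
    define lt where "lt \<longleftrightarrow> cs \<noteq> [] \<and> Min (dist b ` set cs) < Min (dist x ` set cs)"
    have 2: "runs \<rho> (Fork tail2 arg1) ?v (VPair (VPt b) (enc_pts cs)) 10"
      and 3: "runs \<rho> (Fork arg0 arg1) ?v (VPair (VPt x) (enc_pts cs)) 10"
      and 4: "runs \<rho> arg1 ?v (enc_pts cs) 5"
      and 5: "runs \<rho> (Op RLess) (VPair (dist_val b cs) (dist_val x cs))
        (if cs = [] then VUnit else VBool lt) 1"
      by (rule runs_straight; simp add: b(2) dist_val_def lt_def)+
    note 6 = runs_Seq[OF runs_Fork[OF runs_Seq[OF 2 runs_nearest_prog] runs_Seq[OF 3 runs_nearest_prog]] 5]
    define b' where "b' = (if lt then x else b)"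
    have 7: "runs \<rho> arg0 ?v (VPt x) 5" "runs \<rho> tail2 ?v (VPt b) 5"
      by (rule runs_straight; simp add: b(2))+
    have 8: "runs \<rho> (If (op2 RLess (Seq (Fork tail2 arg1) nearest_prog) (Seq (Fork arg0 arg1) nearest_prog))
        arg0 tail2) ?v (VPt b') (1 + (1 + (1 + (1 + 10 + 700 * (length cs + 1)) +
          (1 + 10 + 700 * (length cs + 1))) + 1) + 5)"
      using lt_def by (intro runs_If[OF 6]) (use 7 in \<open>auto simp: b'_def split: if_splits\<close>)
    have "runs \<rho> farthest_step ?v (VPair (enc_pts cs) (VPt b')) ?B"
      unfolding farthest_step_def by (rule runs_conv[OF runs_Fork[OF 4 8]]) simp_all
    moreover have "?I (ys @ [x]) (VPair (enc_pts cs) (VPt b'))"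
    proof (rule bexI[of _ b'], intro conjI refl ballI)
      fix x' assume "x' \<in> set (ys @ [x])"
      then show "?far x' b'"
        using b(3) Min[of b x] Min[of x b] unfolding b'_def lt_def
        by (cases "x' = x") (smt (verit, best) UnE empty_iff list.set(1) list.set(2) insertE set_append)+
    next
      show "b' \<in> set rest" using b(1) xs by (auto simp: b'_def)
    qed
    ultimately show "\<exists>a'. runs \<rho> farthest_step ?v a' ?B \<and> ?I (ys @ [x]) a'" by blast
  qed
  then obtain b where b: "b \<in> set rest" "\<forall>x\<in>set rest. ?far x b"
    and 2: "runs \<rho> (fold_prog farthest_step) (VPair (enc_pts rest) (VPair (enc_pts cs) (VPt (hd rest))))
      (VPair (enc_pts cs) (VPt b)) (15 * (?B + 1) * (length rest + 1))" by blast
  have 3: "runs \<rho> tail1 (VPair (enc_pts cs) (VPt b)) (VPt b) 1"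
    by (rule runs_straight) simp_all
  have "runs \<rho> farthest_prog (enc_cand (rest, cs)) (VPt b) (23000 * ((length cs + 1) * (length rest + 1)))"
    unfolding farthest_prog_def
    by (rule runs_conv[OF runs_Seq[OF runs_Seq[OF 1 2] 3]]) (simp_all add: algebra_simps)
  then show ?thesis using b by blast
qed

definition traverse_step :: prog where
  "traverse_step = If (Seq arg0 (Op IsPair)) (Seq (Fork farthest_prog Skip) remove_prog) Skip"

lemma remove_pt_facts:
  assumes "distinct (fst c @ snd c)"
  shows "distinct (fst (remove_pt y c) @ snd (remove_pt y c))"
    and "set (fst (remove_pt y c)) \<union> set (snd (remove_pt y c)) = set (fst c) \<union> set (snd c)"
    and "set (fst (remove_pt y c)) = set (fst c) - {y}"
    and "y \<in> set (fst c) \<Longrightarrow> snd (remove_pt y c) = y # snd c"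
    and "y \<notin> set (fst c) \<Longrightarrow> snd (remove_pt y c) = snd c"
proof -
  show y: "snd (remove_pt y c) = y # snd c" if "y \<in> set (fst c)"
  proof -
    have "filter (\<lambda>x. x = y) (fst c) = [y]"
      using assms that by (induction "fst c" arbitrary: c) (auto simp: filter_empty_conv)
    then show ?thesis by (simp add: remove_pt_def)
  qed
  show ny: "snd (remove_pt y c) = snd c" if "y \<notin> set (fst c)"
    using that by (auto simp: remove_pt_def filter_empty_conv)
  show "distinct (fst (remove_pt y c) @ snd (remove_pt y c))"
    using assms by (cases "y \<in> set (fst c)") (auto simp: y ny, auto simp: remove_pt_def)
  show "set (fst (remove_pt y c)) \<union> set (snd (remove_pt y c)) = set (fst c) \<union> set (snd c)"
    by (auto simp: remove_pt_def)
  show "set (fst (remove_pt y c)) = set (fst c) - {y}" by (auto simp: remove_pt_def)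
qed

lemma runs_traverse_step:
  "\<exists>p. runs \<rho> traverse_step (enc_cand (rest, cs))
      (enc_cand (if rest = [] then (rest, cs) else remove_pt p (rest, cs)))
      (25000 * ((length cs + 1) * (length rest + 1))) \<and>
    (rest \<noteq> [] \<longrightarrow> p \<in> set rest \<and>
      (\<forall>x\<in>set rest. \<forall>r. (\<forall>c\<in>set cs. r \<le> dist x c) \<longrightarrow> (\<forall>c\<in>set cs. r \<le> dist p c)))"
proof (cases "rest = []")
  case True
  have "runs \<rho> traverse_step (enc_cand (rest, cs)) (enc_cand (rest, cs))
      (25000 * ((length cs + 1) * (length rest + 1)))"
    unfolding traverse_step_def
    by (rule runs_conv[OF runs_If[where g = "VBool False" and s = 3 and t = 1]])
      (auto intro!: runs_straight simp: True enc_cand_def)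
  then show ?thesis using True by auto
next
  case False
  from runs_farthest_prog[OF False] obtain p where p: "p \<in> set rest"
    and far: "\<forall>x\<in>set rest. \<forall>r. (\<forall>c\<in>set cs. r \<le> dist x c) \<longrightarrow> (\<forall>c\<in>set cs. r \<le> dist p c)"
    and 1: "runs \<rho> farthest_prog (enc_cand (rest, cs)) (VPt p)
      (23000 * ((length cs + 1) * (length rest + 1)))" by blast
  have 2: "runs \<rho> Skip (enc_cand (rest, cs)) (enc_cand (rest, cs)) 1"
    and 3: "runs \<rho> (Seq arg0 (Op IsPair)) (enc_cand (rest, cs)) (VBool True) 3"
    by (rule runs_straight; use False in \<open>cases rest; simp add: enc_cand_def\<close>)+
  note 4 = runs_Seq[OF runs_Fork[OF 1 2] runs_remove_prog]
  have "runs \<rho> traverse_step (enc_cand (rest, cs)) (enc_cand (remove_pt p (rest, cs)))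
      (25000 * ((length cs + 1) * (length rest + 1)))"
    unfolding traverse_step_def
    by (rule runs_conv[OF runs_If[OF 3 4]]) (simp_all add: algebra_simps)
  then show ?thesis using False p far by auto
qed

definition traverse_prog :: prog where
  "traverse_prog = Seq (Fork arg0 (Fork arg1 UnitC)) (repeat_prog traverse_step)"

text \<open>The last conjunct is the certificate. When \<open>p\<close> is picked, any point that
  survives with distance at least \<open>r\<close> from all picks was already available before. The
  old certificate separates the earlier picks, and \<open>p\<close>, being farthest, is at least
  \<open>r\<close> away from them too. Only an exhausted input can leave fewer than \<open>G\<close>
  picks.\<close>

lemma runs_traverse_prog:
  assumes "distinct xs"
  shows "\<exists>rest cs. runs \<rho> traverse_prog (VPair (VNat G) (enc_cand (xs, R))) (enc_cand (rest, cs))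
      (380000 * ((G + 1) ^ 2 * (length xs + 1))) \<and>
    distinct (rest @ cs) \<and> set rest \<union> set cs = set xs \<and> length cs \<le> G \<and>
    (rest \<noteq> [] \<longrightarrow> length cs = G) \<and>
    (\<forall>x\<in>set rest. \<forall>r. (\<forall>c\<in>set cs. r \<le> dist x c) \<longrightarrow> separated (set cs) r)"
proof -
  let ?P = "\<lambda>i rest cs. distinct (rest @ cs) \<and> set rest \<union> set cs = set xs \<and> length cs \<le> i \<and>
    (rest \<noteq> [] \<longrightarrow> length cs = i) \<and>
    (\<forall>x\<in>set rest. \<forall>r. (\<forall>c\<in>set cs. r \<le> dist x c) \<longrightarrow> separated (set cs) r)"
  let ?I = "\<lambda>i a. \<exists>rest cs. a = enc_cand (rest, cs) \<and> ?P i rest cs"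
  let ?B = "25000 * ((G + 1) * (length xs + 1))"
  have 1: "runs \<rho> (Fork arg0 (Fork arg1 UnitC)) (VPair (VNat G) (enc_cand (xs, R)))
      (VPair (VNat G) (enc_cand (xs, []))) 10"
    by (rule runs_straight) (simp_all add: enc_cand_def)
  have "\<exists>a'. runs \<rho> (repeat_prog traverse_step) (VPair (VNat G) (enc_cand (xs, []))) a'
      (15 * (?B + 1) * (G + 1)) \<and> ?I G a'"
  proof (rule runs_repeat_prog[where I = ?I])
    show "?I 0 (enc_cand (xs, []))"
      by (rule exI[of _ xs], rule exI[of _ "[]"]) (use assms in \<open>auto simp: separated_def\<close>)
  next
    fix i a assume i: "i < G" and "?I i a"
    then obtain rest cs where a: "a = enc_cand (rest, cs)" and P: "?P i rest cs" by blast
    have "length rest = card (set rest)" using P by (simp add: distinct_card)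
    also have "\<dots> \<le> card (set xs)" by (rule card_mono) (use P in auto)
    finally have len: "length rest \<le> length xs" using card_length le_trans by blast
    have time: "25000 * ((length cs + 1) * (length rest + 1)) \<le> ?B"
      using len P i by (intro mult_left_mono mult_mono) auto
    obtain p where run: "runs \<rho> traverse_step a
        (enc_cand (if rest = [] then (rest, cs) else remove_pt p (rest, cs))) ?B"
      and p: "rest \<noteq> [] \<Longrightarrow> p \<in> set rest"
      and far: "\<And>x r. x \<in> set rest \<Longrightarrow> \<forall>c\<in>set cs. r \<le> dist x c \<Longrightarrow> \<forall>c\<in>set cs. r \<le> dist p c"
      using runs_traverse_step[of \<rho> rest cs] runs_conv[OF _ refl time] unfolding a
      by (metis empty_iff list.set(1))
    show "\<exists>a'. runs \<rho> traverse_step a a' ?B \<and> ?I (Suc i) a'"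
    proof (cases "rest = []")
      case True
      then show ?thesis using run P by force
    next
      case False
      define rest' where "rest' = fst (remove_pt p (rest, cs))"
      have pm: "p \<in> set rest" using p False by blast
      have eq: "remove_pt p (rest, cs) = (rest', p # cs)"
        using remove_pt_facts(4)[of "(rest, cs)" p] P pm by (simp add: rest'_def prod_eq_iff)
      have r': "set rest' = set rest - {p}" "distinct (rest' @ p # cs)"
        using remove_pt_facts(1,3)[of "(rest, cs)" p] P eq by auto
      have "separated (set (p # cs)) r" if x: "x \<in> set rest'" "\<forall>c\<in>set (p # cs). r \<le> dist x c" for x r
      proof -
        have "separated (set cs) r" "\<forall>c\<in>set cs. r \<le> dist p c"
          using x r'(1) P far[of x r] by auto
        then show ?thesis by (auto simp: separated_def dist_commute)
      qed
      then have "?P (Suc i) rest' (p # cs)"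
        using r' P pm False by auto
      then have "?I (Suc i) (enc_cand (rest', p # cs))" by blast
      moreover have "runs \<rho> traverse_step a (enc_cand (rest', p # cs)) ?B"
        using run False eq by simp
      ultimately show ?thesis by blast
    qed
  qed
  then obtain rest cs where P: "?P G rest cs"
    and 2: "runs \<rho> (repeat_prog traverse_step) (VPair (VNat G) (enc_cand (xs, []))) (enc_cand (rest, cs))
      (15 * (?B + 1) * (G + 1))" by blast
  have "runs \<rho> traverse_prog (VPair (VNat G) (enc_cand (xs, R))) (enc_cand (rest, cs))
      (380000 * ((G + 1) ^ 2 * (length xs + 1)))"
    unfolding traverse_prog_def
    by (rule runs_conv[OF runs_Seq[OF 1 2]]) (simp_all add: power2_eq_square algebra_simps)
  then show ?thesis using P by blast
qed

section \<open>The pool of possible outliers\<close>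

definition round_prog :: prog where
  "round_prog =
     Seq (Fork (Fork arg0 tail2) traverse_prog)
       (Fork (fst_of arg0) (Fork arg1 (Seq (Fork tail2 (snd_of arg0)) (fold_prog Skip))))"

text \<open>The pair of element and accumulator is itself the encoding of a list with one more
  element, so folding \<open>Skip\<close> reverses and appends.\<close>

lemma runs_fold_Skip:
  "runs \<rho> (fold_prog Skip) (VPair (enc_list e xs) (enc_list e ys)) (enc_list e (rev xs @ ys))
     (30 * (length xs + 1))"
  using runs_fold_prog_fun[of xs \<rho> Skip e "\<lambda>zs. enc_list e (rev zs @ ys)" 1]
  by (simp add: runs_straight)

lemma runs_round_prog:
  assumes "distinct xs"
  shows "\<exists>rest cs. runs \<rho> round_prog (VPair (VNat G) (enc_cand (xs, R))) (VPair (VNat G) (enc_cand (rest, rev cs @ R)))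
      (400000 * ((G + 1) ^ 2 * (length xs + 1))) \<and>
    distinct (rest @ cs) \<and> set rest \<union> set cs = set xs \<and> length cs \<le> G \<and>
    (rest \<noteq> [] \<longrightarrow> length cs = G) \<and>
    (\<forall>x\<in>set rest. \<forall>r. (\<forall>c\<in>set cs. r \<le> dist x c) \<longrightarrow> separated (set cs) r)"
proof -
  let ?v = "VPair (VNat G) (enc_cand (xs, R))"
  obtain rest cs where 1: "runs \<rho> traverse_prog ?v (enc_cand (rest, cs))
      (380000 * ((G + 1) ^ 2 * (length xs + 1)))"
    and rest: "distinct (rest @ cs) \<and> set rest \<union> set cs = set xs \<and> length cs \<le> G \<and>
    (rest \<noteq> [] \<longrightarrow> length cs = G) \<and>
    (\<forall>x\<in>set rest. \<forall>r. (\<forall>c\<in>set cs. r \<le> dist x c) \<longrightarrow> separated (set cs) r)"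
    using runs_traverse_prog[OF assms, of \<rho> G R] by (elim exE conjE) blast
  have len: "length cs \<le> G" using rest by blast
  let ?u = "VPair (VPair (VNat G) (enc_pts R)) (enc_cand (rest, cs))"
  have 2: "runs \<rho> (Fork arg0 tail2) ?v (VPair (VNat G) (enc_pts R)) 10"
    and 3: "runs \<rho> (fst_of arg0) ?u (VNat G) 3"
    and 4: "runs \<rho> arg1 ?u (enc_pts rest) 3"
    and 5: "runs \<rho> (Fork tail2 (snd_of arg0)) ?u (VPair (enc_pts cs) (enc_pts R)) 10"
    by (rule runs_straight; simp add: enc_cand_def)+
  define E where "E = (G + 1) ^ 2 * (length xs + 1)"
  note 6 = runs_Seq[OF runs_Fork[OF 2 1[folded E_def]]
      runs_Fork[OF 3 runs_Fork[OF 4 runs_Seq[OF 5 runs_fold_Skip]]]]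
  have "(G + 1) * 1 \<le> (G + 1) * ((G + 1) * (length xs + 1))"
    by (intro mult_left_mono) simp_all
  then have E: "G + 1 \<le> E" by (simp add: E_def power2_eq_square mult.assoc)
  have "runs \<rho> round_prog ?v (VPair (VNat G) (enc_cand (rest, rev cs @ R))) (400000 * E)"
    unfolding round_prog_def
    by (rule runs_conv[OF 6]) (use len E in \<open>simp_all add: enc_cand_def\<close>)
  then show ?thesis using rest unfolding E_def by blast
qed

definition pool_prog :: prog where
  "pool_prog = snd_of (snd_of (Seq (Fork arg0 (Fork arg1 (Fork tail2 UnitC))) (repeat_prog round_prog)))"

text \<open>A point that survives a round gains one neighbour, its nearest pick in that round.
  Neighbours from different rounds differ because picks leave the list, so surviving all
  \<open>m\<close> rounds yields \<open>m\<close> of them.\<close>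

lemma runs_pool_prog:
  assumes "distinct xs" and G: "1 \<le> G"
  shows "\<exists>R. runs \<rho> pool_prog (VPair (VNat m) (VPair (VNat G) (enc_pts xs))) (enc_pts R)
      (7000000 * ((m + 1) * ((G + 1) ^ 2 * (length xs + 1)))) \<and>
    set R \<subseteq> set xs \<and> length R \<le> m * G \<and>
    (\<forall>x\<in>set xs - set R. \<exists>N\<subseteq>set R. card N = m \<and>
       (\<forall>y\<in>N. \<exists>C\<subseteq>set xs. card C = G \<and> separated C (dist x y)))"
proof -
  let ?near = "\<lambda>x y. \<exists>C\<subseteq>set xs. card C = G \<and> separated C (dist x y)"
  let ?P = "\<lambda>i rest R. distinct (rest @ R) \<and> set rest \<union> set R = set xs \<and> length R \<le> i * G \<and>
    (\<forall>x\<in>set rest. \<exists>N\<subseteq>set R. card N = i \<and> (\<forall>y\<in>N. ?near x y))"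
  let ?I = "\<lambda>i a. \<exists>rest R. a = VPair (VNat G) (enc_cand (rest, R)) \<and> ?P i rest R"
  define E where "E = (G + 1) ^ 2 * (length xs + 1)"
  have E: "1 \<le> E" by (simp add: E_def Suc_le_eq)
  have 1: "runs \<rho> (Fork arg0 (Fork arg1 (Fork tail2 UnitC)))
      (VPair (VNat m) (VPair (VNat G) (enc_pts xs)))
      (VPair (VNat m) (VPair (VNat G) (enc_cand (xs, [])))) 15"
    by (rule runs_straight) (simp_all add: enc_cand_def)
  have "\<exists>a'. runs \<rho> (repeat_prog round_prog) (VPair (VNat m) (VPair (VNat G) (enc_cand (xs, [])))) a'
      (15 * (400000 * E + 1) * (m + 1)) \<and> ?I m a'"
  proof (rule runs_repeat_prog[where I = ?I])
    show "?I 0 (VPair (VNat G) (enc_cand (xs, [])))"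
      by (rule exI[of _ xs], rule exI[of _ "[]"]) (use assms in auto)
  next
    fix i a assume "?I i a"
    then obtain rest R where a: "a = VPair (VNat G) (enc_cand (rest, R))" and P: "?P i rest R" by blast
    have d: "distinct rest" "distinct (rest @ R)" using P by auto
    have "length rest = card (set rest)" using d by (simp add: distinct_card)
    also have "\<dots> \<le> card (set xs)" by (rule card_mono) (use P in auto)
    finally have len: "length rest \<le> length xs" using card_length le_trans by blast
    then have time: "400000 * ((G + 1) ^ 2 * (length rest + 1)) \<le> 400000 * E"
      unfolding E_def by (intro mult_left_mono) auto
    from runs_round_prog[OF d(1), of \<rho> G R] obtain rest' cs where
      run: "runs \<rho> round_prog a (VPair (VNat G) (enc_cand (rest', rev cs @ R)))
        (400000 * ((G + 1) ^ 2 * (length rest + 1)))"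
      and d': "distinct (rest' @ cs)" and set': "set rest' \<union> set cs = set rest"
      and lcs: "length cs \<le> G" "rest' \<noteq> [] \<Longrightarrow> length cs = G"
      and sep: "\<And>x r. x \<in> set rest' \<Longrightarrow> \<forall>c\<in>set cs. r \<le> dist x c \<Longrightarrow> separated (set cs) r"
      unfolding a by blast
    have "\<exists>N\<subseteq>set (rev cs @ R). card N = Suc i \<and> (\<forall>y\<in>N. ?near x y)" if x: "x \<in> set rest'" for x
    proof -
      obtain N where N: "N \<subseteq> set R" "card N = i" "\<forall>y\<in>N. ?near x y"
        using P x set' by blast
      have lG: "length cs = G" using lcs(2) x by fastforce
      then have "cs \<noteq> []" using G by auto
      \<comment> \<open>A survivor implies a full round of \<open>G\<close> picks, and
        \<open>G\<close> is positive, so a nearest pick exists. Its distance is a lower bound for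
        the distances to all picks, which is what the certificate \<open>sep\<close> asks
        for.\<close>
      then obtain c where c: "c \<in> set cs" "\<forall>c'\<in>set cs. dist x c \<le> dist x c'"
        using ex_is_arg_min_if_finite[of "set cs" "dist x"] by (auto simp: is_arg_min_linorder)
      have "card (set cs) = G" using d' lG by (simp add: distinct_card)
      moreover have "set cs \<subseteq> set xs" using P set' by auto
      ultimately have "?near x c" using sep[OF x c(2)] by blast
      moreover have "c \<notin> N" using N(1) c(1) set' d by auto
      moreover have "finite N" using N(1) finite_subset by blast
      ultimately show ?thesis
        using N c(1) by (intro exI[of _ "insert c N"]) auto
    qed
    then have "?P (Suc i) rest' (rev cs @ R)"
      using d' set' lcs(1) P by auto
    then show "\<exists>a'. runs \<rho> round_prog a a' (400000 * E) \<and> ?I (Suc i) a'"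
      using runs_conv[OF run refl time] by blast
  qed
  then obtain rest R where P: "?P m rest R" and
    2: "runs \<rho> (repeat_prog round_prog) (VPair (VNat m) (VPair (VNat G) (enc_cand (xs, []))))
      (VPair (VNat G) (enc_cand (rest, R))) (15 * (400000 * E + 1) * (m + 1))" by blast
  have 3: "runs \<rho> tail1 (VPair (VNat G) (enc_cand (rest, R))) (enc_cand (rest, R)) 1"
    and 4: "runs \<rho> tail1 (enc_cand (rest, R)) (enc_pts R) 1"
    by (rule runs_straight; simp add: enc_cand_def)+
  have "1 * (m + 1) \<le> E * (m + 1)" using E by (intro mult_right_mono) auto
  then have "runs \<rho> pool_prog (VPair (VNat m) (VPair (VNat G) (enc_pts xs))) (enc_pts R)
      (7000000 * ((m + 1) * E))"
    unfolding pool_prog_def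
    by (intro runs_conv[OF runs_Seq[OF runs_Seq[OF runs_Seq[OF 1 2] 3] 4]])
      (use E in \<open>simp_all add: algebra_simps\<close>)
  moreover have "set xs - set R \<subseteq> set rest" using P by auto
  ultimately show ?thesis using P unfolding E_def by (intro exI[of _ R]) blast
qed

section \<open>Enumeration of outlier sets\<close>

definition branch :: "'p list \<Rightarrow> ('p list \<times> 'p list) list \<Rightarrow> ('p list \<times> 'p list) list" where
  "branch R cs = concat (map (\<lambda>c. rev (map (\<lambda>y. remove_pt y c) R) @ [c]) (rev cs))"

definition branch_inner_step :: prog where
  "branch_inner_step = Fork arg1 (Fork (Seq (Fork arg0 arg1) remove_prog) tail2)"

definition branch_step :: prog where
  "branch_step =
     Fork arg1 (snd_of (Seq (Fork arg1 (Fork arg0 (Fork arg0 tail2))) (fold_prog branch_inner_step)))"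

definition branch_prog :: prog where
  "branch_prog = Seq (Fork tail1 (Fork arg0 UnitC)) (fold_prog branch_step)"

lemma runs_branch_prog:
  assumes len: "\<And>c. c \<in> set cs \<Longrightarrow> length (fst c) \<le> n"
  shows "runs \<rho> branch_prog (VPair (enc_pts R) (enc_list enc_cand cs))
      (VPair (enc_pts R) (enc_list enc_cand (branch R cs)))
      (240000 * ((n + 1) * (length R + 1) * (length cs + 1)))"
proof -
  let ?g = "\<lambda>ys. VPair (enc_pts R) (enc_list enc_cand (branch R ys))"
  define E where "E = (n + 1) * (length R + 1)"
  have E: "1 \<le> E" by (simp add: E_def)
  have step: "runs \<rho> branch_step (VPair (enc_cand c) (?g ys)) (?g (ys @ [c])) (15500 * E)"
    if c: "c \<in> set cs" for c ys
  proof -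
    let ?h = "\<lambda>zs. VPair (enc_cand c)
      (enc_list enc_cand (rev (map (\<lambda>y. remove_pt y c) zs) @ c # branch R ys))"
    let ?v = "VPair (enc_cand c) (?g ys)"
    have 1: "runs \<rho> (Fork arg1 (Fork arg0 (Fork arg0 tail2))) ?v (VPair (enc_pts R) (?h [])) 15"
      by (rule runs_straight) simp_all
    have 2: "runs \<rho> (fold_prog branch_inner_step) (VPair (enc_pts R) (?h [])) (?h R)
        (15 * (1020 * (n + 1) + 1) * (length R + 1))"
    proof (rule runs_fold_prog_fun)
      fix zs y ws
      let ?w = "VPair (VPt y) (?h zs)"
      have 3: "runs \<rho> arg1 ?w (enc_cand c) 3"
        and 4: "runs \<rho> (Fork arg0 arg1) ?w (VPair (VPt y) (enc_cand c)) 5"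
        and 5: "runs \<rho> tail2 ?w (enc_list enc_cand (rev (map (\<lambda>y. remove_pt y c) zs) @ c # branch R ys)) 3"
        by (rule runs_straight; simp)+
      show "runs \<rho> branch_inner_step ?w (?h (zs @ [y])) (1020 * (n + 1))"
        unfolding branch_inner_step_def
        by (rule runs_conv[OF runs_Fork[OF 3 runs_Fork[OF runs_Seq[OF 4 runs_remove_prog] 5]]])
          (use len[OF c] in simp_all)
    qed
    have 3: "runs \<rho> arg1 ?v (enc_pts R) 3"
      and 4: "runs \<rho> tail1 (?h R) (enc_list enc_cand (branch R (ys @ [c]))) 1"
      by (rule runs_straight; simp add: branch_def)+
    show ?thesis
      unfolding branch_step_def
      by (rule runs_conv[OF runs_Fork[OF 3 runs_Seq[OF runs_Seq[OF 1 2] 4]]])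
        (simp_all add: E_def algebra_simps)
  qed
  have 1: "runs \<rho> (Fork tail1 (Fork arg0 UnitC)) (VPair (enc_pts R) (enc_list enc_cand cs))
      (VPair (enc_list enc_cand cs) (?g [])) 10"
    by (rule runs_straight) (simp_all add: branch_def)
  have 2: "runs \<rho> (fold_prog branch_step) (VPair (enc_list enc_cand cs) (?g [])) (?g cs)
      (15 * (15500 * E + 1) * (length cs + 1))"
    by (rule runs_fold_prog_fun) (use step in auto)
  have "1 * (length cs + 1) \<le> E * (length cs + 1)" using E by (intro mult_right_mono) auto
  then show ?thesis
    unfolding branch_prog_def E_def[symmetric]
    by (intro runs_conv[OF runs_Seq[OF 1 2]]) (simp_all add: algebra_simps)
qed

definition candidates_prog :: prog where
  "candidates_prog =
     snd_of (Seq (Fork arg0 (Fork arg1 (Fork (Fork tail2 UnitC) UnitC))) (repeat_prog branch_prog))"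

text \<open>A round keeps every candidate and adds, for each \<open>y\<close> in \<open>R\<close>, a
  copy with \<open>y\<close> moved to the outliers; this multiplies their number by
  \<open>Q\<close>. Kept candidates account for the smaller sets and copies for those with one more
  element. Sets may occur repeatedly, which spares any comparison of sets and still respects the
  bound \<open>Q ^ m\<close>.\<close>

lemma runs_candidates_prog:
  assumes xs: "distinct xs" and R: "set R \<subseteq> set xs"
  defines "Q \<equiv> length R + 1"
  shows "\<exists>cs. runs \<rho> candidates_prog (VPair (VNat m) (VPair (enc_pts R) (enc_pts xs))) (enc_list enc_cand cs)
      (8000000 * ((length xs + 1) * Q * Q ^ m * (m + 1))) \<and>
    length cs \<le> Q ^ m \<and>
    (\<forall>c\<in>set cs. distinct (fst c @ snd c) \<and> set (fst c) \<union> set (snd c) = set xs \<and> length (snd c) \<le> m) \<and>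
    (\<forall>Y\<subseteq>set R. card Y \<le> m \<longrightarrow> (\<exists>c\<in>set cs. set (snd c) = Y))"
proof -
  let ?ok = "\<lambda>i c. distinct (fst c @ snd c) \<and> set (fst c) \<union> set (snd c) = set xs \<and> length (snd c) \<le> i"
  let ?P = "\<lambda>i cs. length cs \<le> Q ^ i \<and> (\<forall>c\<in>set cs. ?ok i c) \<and>
    (\<forall>Y\<subseteq>set R. card Y \<le> i \<longrightarrow> (\<exists>c\<in>set cs. set (snd c) = Y))"
  let ?I = "\<lambda>i a. \<exists>cs. a = VPair (enc_pts R) (enc_list enc_cand cs) \<and> ?P i cs"
  let ?cs0 = "[(xs, [])] :: ('a list \<times> 'a list) list"
  define E where "E = (length xs + 1) * Q * Q ^ m"
  have Q: "1 \<le> Q" by (simp add: Q_def)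
  then have E: "1 \<le> E" by (simp add: E_def Suc_le_eq)
  have 1: "runs \<rho> (Fork arg0 (Fork arg1 (Fork (Fork tail2 UnitC) UnitC)))
      (VPair (VNat m) (VPair (enc_pts R) (enc_pts xs)))
      (VPair (VNat m) (VPair (enc_pts R) (enc_list enc_cand ?cs0))) 20"
    by (rule runs_straight) (simp_all add: enc_cand_def)
  have "\<exists>a'. runs \<rho> (repeat_prog branch_prog) (VPair (VNat m) (VPair (enc_pts R) (enc_list enc_cand ?cs0))) a'
      (15 * (480000 * E + 1) * (m + 1)) \<and> ?I m a'"
  proof (rule runs_repeat_prog[where I = ?I])
    have "?P 0 ?cs0" using xs finite_subset by fastforce
    then show "?I 0 (VPair (enc_pts R) (enc_list enc_cand ?cs0))" by blast
  next
    fix i a assume i: "i < m" and "?I i a"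
    then obtain cs where a: "a = VPair (enc_pts R) (enc_list enc_cand cs)" and P: "?P i cs" by blast
    have len: "length (fst c) \<le> length xs" if "c \<in> set cs" for c
    proof -
      have "length (fst c) = card (set (fst c))" using P that by (simp add: distinct_card)
      also have "\<dots> \<le> card (set xs)" by (rule card_mono) (use P that in auto)
      finally show ?thesis using card_length le_trans by blast
    qed
    have "Q ^ i \<le> Q ^ m" "1 \<le> Q ^ m" using Q i by (auto intro: power_increasing)
    then have "length cs + 1 \<le> 2 * Q ^ m" using P by linarith
    then have "240000 * ((length xs + 1) * (length R + 1) * (length cs + 1))
        \<le> 240000 * ((length xs + 1) * (length R + 1) * (2 * Q ^ m))"
      by (intro mult_left_mono) auto
    then have time: "240000 * ((length xs + 1) * (length R + 1) * (length cs + 1)) \<le> 480000 * E"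
      by (simp add: E_def Q_def algebra_simps)
    have mem: "set (branch R cs) = set cs \<union> (\<Union>c\<in>set cs. (\<lambda>y. remove_pt y c) ` set R)"
      by (auto simp: branch_def)
    have "length (branch R cs) = Q * length cs"
      by (induction cs) (auto simp: branch_def Q_def)
    then have "length (branch R cs) \<le> Q ^ Suc i" using P by simp
    moreover have "?ok (Suc i) c" if c: "c \<in> set (branch R cs)" for c
    proof -
      consider "c \<in> set cs" | c' y where "c' \<in> set cs" "c = remove_pt y c'"
        using c unfolding mem by blast
      then show ?thesis
      proof cases
        case 2
        then have ok: "?ok i c'" using P by blast
        then have d: "distinct (fst c' @ snd c')" by blast
        have "length (snd c) \<le> Suc (length (snd c'))"
          using remove_pt_facts(4,5)[OF d, of y] 2(2) by (cases "y \<in> set (fst c')") auto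
        then show ?thesis using remove_pt_facts(1,2)[OF d, of y] 2(2) ok by auto
      qed (use P in force)
    qed
    moreover have "\<exists>c\<in>set (branch R cs). set (snd c) = Y" if Y: "Y \<subseteq> set R" "card Y \<le> Suc i" for Y
    proof (cases "card Y \<le> i")
      case True
      then show ?thesis using P Y(1) mem by blast
    next
      case False
      then have cY: "card Y = Suc i" using Y(2) by simp
      then obtain y Y' where Y': "Y = insert y Y'" "y \<notin> Y'" "card Y' = i"
        by (meson card_Suc_eq)
      then obtain c where c: "c \<in> set cs" "set (snd c) = Y'"
        using P Y(1) by blast
      have d: "distinct (fst c @ snd c)" "set (fst c) \<union> set (snd c) = set xs" using P c(1) by auto
      have "y \<in> set (fst c)" using Y' Y(1) R c(2) d(2) by blast
      then have "set (snd (remove_pt y c)) = Y"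
        using remove_pt_facts(4)[OF d(1)] c(2) Y'(1) by simp
      moreover have "remove_pt y c \<in> set (branch R cs)"
        using mem c(1) Y(1) Y'(1) by blast
      ultimately show ?thesis by blast
    qed
    ultimately have "?P (Suc i) (branch R cs)" by blast
    then show "\<exists>a'. runs \<rho> branch_prog a a' (480000 * E) \<and> ?I (Suc i) a'"
      using runs_conv[OF runs_branch_prog[OF len] refl time] unfolding a by blast
  qed
  then obtain cs where P: "?P m cs"
    and 2: "runs \<rho> (repeat_prog branch_prog) (VPair (VNat m) (VPair (enc_pts R) (enc_list enc_cand ?cs0)))
      (VPair (enc_pts R) (enc_list enc_cand cs)) (15 * (480000 * E + 1) * (m + 1))" by blast
  have 3: "runs \<rho> tail1 (VPair (enc_pts R) (enc_list enc_cand cs)) (enc_list enc_cand cs) 1"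
    by (rule runs_straight) simp_all
  have "1 * (m + 1) \<le> E * (m + 1)" using E by (intro mult_right_mono) auto
  then have "runs \<rho> candidates_prog (VPair (VNat m) (VPair (enc_pts R) (enc_pts xs))) (enc_list enc_cand cs)
      (8000000 * (E * (m + 1)))"
    unfolding candidates_prog_def
    by (intro runs_conv[OF runs_Seq[OF runs_Seq[OF 1 2] 3]]) (use E in \<open>simp_all add: algebra_simps\<close>)
  then show ?thesis using P unfolding E_def by blast
qed

section \<open>Evaluating the cost of a solution\<close>

definition power_dist :: "nat \<Rightarrow> prog" where
  "power_dist z = (if z = 1 then op2 Dist arg0 arg1 else op2 RMul (op2 Dist arg0 arg1) (op2 Dist arg0 arg1))"

definition cost_inner_step :: "nat \<Rightarrow> prog" where
  "cost_inner_step z = Fork arg1 (op2 RAdd tail2 (power_dist z))"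

text \<open>The accumulator carries the centers not yet consumed along with the running total, so a
  fold over the clusters walks through both lists in lockstep.\<close>

definition cost_step :: "nat \<Rightarrow> prog" where
  "cost_step z =
     Fork (snd_of arg1) (snd_of (Seq (Fork arg0 (Fork (fst_of arg1) tail2)) (fold_prog (cost_inner_step z))))"

definition cost_prog :: "nat \<Rightarrow> prog" where
  "cost_prog z = snd_of (Seq (Fork arg0 (Fork tail1 (RealC 0))) (fold_prog (cost_step z)))"

lemma runs_cost_prog:
  assumes z: "z \<in> {1, 2}" and len: "length xss = length fs"
    and xss: "\<And>ys. ys \<in> set xss \<Longrightarrow> distinct ys \<and> length ys \<le> n"
  shows "runs \<rho> (cost_prog z) (VPair (enc_list enc_pts xss) (enc_pts fs)) (VReal (cost z (map set xss) fs))
     (11000 * ((n + 1) * (length fs + 1)))"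
proof -
  let ?g = "\<lambda>yss :: 'a list list. VPair (enc_pts (drop (length yss) fs))
    (VReal (\<Sum>i<length yss. \<Sum>x\<in>set (xss ! i). dist x (fs ! i) ^ z))"
  have step: "runs \<rho> (cost_step z) (VPair (enc_pts ys) (?g yss)) (?g (yss @ [ys])) (700 * (n + 1))"
    if split: "xss = yss @ ys # zss" for ys yss zss
  proof -
    define f where "f = fs ! length yss"
    define tot where "tot = (\<Sum>i<length yss. \<Sum>x\<in>set (xss ! i). dist x (fs ! i) ^ z)"
    have fs: "drop (length yss) fs = f # drop (Suc (length yss)) fs"
      unfolding f_def by (rule Cons_nth_drop_Suc[symmetric]) (use split len in auto)
    let ?h = "\<lambda>zs. VPair (VPt f) (VReal (tot + (\<Sum>x\<in>set zs. dist x f ^ z)))"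
    let ?v = "VPair (enc_pts ys) (?g yss)"
    have 1: "runs \<rho> (Fork arg0 (Fork (fst_of arg1) tail2)) ?v (VPair (enc_pts ys) (?h [])) 15"
      and 3: "runs \<rho> (snd_of arg1) ?v (enc_pts (drop (length (yss @ [ys])) fs)) 5"
      by (rule runs_straight; simp add: fs tot_def)+
    have 2: "runs \<rho> (fold_prog (cost_inner_step z)) (VPair (enc_pts ys) (?h [])) (?h ys)
        (15 * (40 + 1) * (length ys + 1))"
    proof (rule runs_fold_prog_fun, rule runs_straight)
      fix zs x ws assume "ys = zs @ x # ws"
      \<comment> \<open>\<open>cost\<close> sums over sets while the program sums over a list; the
        two agree because the list has no repetitions.\<close>
      then have "x \<notin> set zs" using xss[of ys] split by auto
      then show "straight_result (cost_inner_step z) (VPair (VPt x) (?h zs)) = ?h (zs @ [x])"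
        using z by (auto simp: cost_inner_step_def power_dist_def power2_eq_square)
    qed (use z in \<open>auto simp: cost_inner_step_def power_dist_def\<close>)
    have 4: "runs \<rho> tail1 (?h ys) (VReal (\<Sum>i<length (yss @ [ys]). \<Sum>x\<in>set (xss ! i). dist x (fs ! i) ^ z)) 1"
      by (rule runs_straight) (simp_all add: tot_def f_def split nth_append)
    have "length ys \<le> n" using xss split by simp
    then show ?thesis
      unfolding cost_step_def
      by (intro runs_conv[OF runs_Fork[OF 3 runs_Seq[OF runs_Seq[OF 1 2] 4]]]) simp_all
  qed
  have 1: "runs \<rho> (Fork arg0 (Fork tail1 (RealC 0))) (VPair (enc_list enc_pts xss) (enc_pts fs))
      (VPair (enc_list enc_pts xss) (?g [])) 10"
    by (rule runs_straight) simp_all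
  have 2: "runs \<rho> (fold_prog (cost_step z)) (VPair (enc_list enc_pts xss) (?g [])) (?g xss)
      (15 * (700 * (n + 1) + 1) * (length xss + 1))"
    by (rule runs_fold_prog_fun[where g = ?g]) (rule step)
  have 3: "runs \<rho> tail1 (?g xss) (VReal (cost z (map set xss) fs)) 1"
    by (rule runs_straight) (simp_all add: cost_def len)
  show ?thesis
    unfolding cost_prog_def
    by (rule runs_conv[OF runs_Seq[OF runs_Seq[OF 1 2] 3]]) (simp_all add: len algebra_simps)
qed

section \<open>Selecting the best candidate\<close>

lemma feasible_no_outliers_extend:
  assumes feas: "feasible W F k 0 chk X0 Xs fs" and W: "finite W" and Y: "W \<inter> Y = {}" "card Y \<le> m"
  shows "feasible (W \<union> Y) F k m chk Y Xs fs"
proof -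
  have part: "is_partition (X0 # Xs) W" and "card X0 = 0"
    using feas by (auto simp: feasible_def)
  moreover have "X0 \<subseteq> W" using part by (auto simp: is_partition_def)
  ultimately have X0: "X0 = {}" using W finite_subset by fastforce
  have D: "(X0 # Xs) ! i \<inter> (X0 # Xs) ! j = {}" if "i < Suc (length Xs)" "j < Suc (length Xs)" "i \<noteq> j" for i j
    using part that by (auto simp: is_partition_def)
  have sub: "Xs ! i \<inter> Y = {}" if "i < length Xs" for i
    using part Y(1) nth_mem[OF that] by (auto simp: is_partition_def)
  have "(Y # Xs) ! i \<inter> (Y # Xs) ! j = {}" if "i < Suc (length Xs)" "j < Suc (length Xs)" "i \<noteq> j" for i j
    using that D[of i j] sub by (cases i; cases j) auto
  then have "is_partition (Y # Xs) (W \<union> Y)"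
    using part X0 by (auto simp: is_partition_def)
  then show ?thesis using feas Y(2) by (auto simp: feasible_def)
qed

text \<open>The correctness half of \<open>approx_alg\<close>, split off from its time bound so that
  it can be carried through the program logic.\<close>

definition good_answer ::
  "nat \<Rightarrow> 'p::metric_space set \<Rightarrow> 'p set \<Rightarrow> nat \<Rightarrow> nat \<Rightarrow> ('p set list \<Rightarrow> 'p list \<Rightarrow> bool)
     \<Rightarrow> real \<Rightarrow> 'p val \<Rightarrow> bool" where
  "good_answer z X F k m chk \<alpha> out \<longleftrightarrow>
     (if \<exists>X0 Xs fs. feasible X F k m chk X0 Xs fs
      then \<exists>x0 xss fs. out = enc_solution x0 xss fs \<and>
             distinct x0 \<and> (\<forall>ys\<in>set xss. distinct ys) \<and>
             feasible X F k m chk (set x0) (map set xss) fs \<and>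
             cost z (map set xss) fs \<le> \<alpha> * opt z X F k m chk
      else out = VUnit)"

lemma opt_le_cost: "feasible X F k m chk X0 Xs fs \<Longrightarrow> opt z X F k m chk \<le> cost z Xs fs"
  unfolding opt_def by (rule cInf_lower) (auto intro: bdd_belowI[of _ 0] cost_nonneg)

lemma opt_nonneg: "feasible X F k m chk X0 Xs fs \<Longrightarrow> 0 \<le> opt z X F k m chk"
  unfolding opt_def by (rule cInf_greatest) (auto intro: cost_nonneg)

text \<open>While nothing is stored, \<open>best\<close> is \<open>VUnit\<close>, the comparison
  fails and the new solution is taken. The outlier list returned by \<open>A\<close>, empty for a
  correct answer, is replaced by the points that the candidate set aside.\<close>

definition update_prog :: prog where
  "update_prog =
     If (op2 RLess (fst_of (snd_of tail3)) arg0) (snd_of tail3)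
       (Fork arg0 (Fork (snd_of arg2) (snd_of arg1)))"

definition select_step :: "nat \<Rightarrow> prog \<Rightarrow> prog" where
  "select_step z A =
     Fork arg1
       (Seq (Fork (Seq (Fork (fst_of arg0) (Fork (fst_of arg1) (Fork (snd_of arg1) (NatC 0)))) A) Skip)
         (If (Seq arg0 (Op IsPair))
           (Seq (Fork (Seq (snd_of arg0) (cost_prog z)) Skip) update_prog)
           tail3))"

definition select_prog :: "nat \<Rightarrow> prog \<Rightarrow> prog" where
  "select_prog z A =
     snd_of (snd_of (Seq (Fork arg0 (Fork tail1 UnitC)) (fold_prog (select_step z A))))"

text \<open>The cheapest solution is within \<alpha> of the outlier-free optimum of every feasible
  candidate simultaneously. Hence it never has to be known which candidate arises from the
  exchange.\<close>

lemma runs_select_prog: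
  assumes z: "z \<in> {1, 2}" and n: "card X \<le> n"
    and cs: "\<And>c. c \<in> set cs \<Longrightarrow> distinct (fst c @ snd c) \<and> set (fst c) \<union> set (snd c) = X \<and> length (snd c) \<le> m"
    and A: "\<And>c. c \<in> set cs \<Longrightarrow>
      \<exists>out. runs \<rho> A (enc_instance (fst c) d k 0) out tA \<and> good_answer z (set (fst c)) F k 0 chk \<alpha> out"
  shows "\<exists>out. runs \<rho> (select_prog z A) (VPair (enc_list enc_cand cs) (VPair d (VNat k))) out
      (15 * (tA + 11200 * ((n + 1) * (k + 1)) + 1) * (length cs + 1) + 20) \<and>
    (if \<exists>c\<in>set cs. \<exists>X0 Xs fs. feasible (set (fst c)) F k 0 chk X0 Xs fs
     then \<exists>x0 xss fs. out = enc_solution x0 xss fs \<and>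
       distinct x0 \<and> (\<forall>ys\<in>set xss. distinct ys) \<and>
       feasible X F k m chk (set x0) (map set xss) fs \<and>
       (\<forall>c\<in>set cs. (\<exists>X0 Xs fs. feasible (set (fst c)) F k 0 chk X0 Xs fs) \<longrightarrow>
          cost z (map set xss) fs \<le> \<alpha> * opt z (set (fst c)) F k 0 chk)
     else out = VUnit)"
proof -
  let ?dk = "VPair d (VNat k)"
  define feas where "feas c \<longleftrightarrow> (\<exists>X0 Xs fs. feasible (set (fst c)) F k 0 chk X0 Xs fs)"
    for c :: "'a list \<times> 'a list"
  let ?sol = "\<lambda>seen x0 xss fs. distinct x0 \<and> (\<forall>ys\<in>set xss. distinct ys) \<and>
       feasible X F k m chk (set x0) (map set xss) fs \<and>
       (\<forall>c\<in>set seen. feas c \<longrightarrow> cost z (map set xss) fs \<le> \<alpha> * opt z (set (fst c)) F k 0 chk)"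
  let ?best = "\<lambda>seen best. (best = VUnit \<and> (\<forall>c\<in>set seen. \<not> feas c)) \<or>
     ((\<exists>c\<in>set seen. feas c) \<and> (\<exists>x0 xss fs. best = VPair (VReal (cost z (map set xss) fs)) (enc_solution x0 xss fs) \<and>
        ?sol seen x0 xss fs))"
  let ?I = "\<lambda>seen a. \<exists>best. a = VPair ?dk best \<and> ?best seen best"
  define E where "E = (n + 1) * (k + 1)"
  have E: "1 \<le> E" by (simp add: E_def)
  let ?B = "tA + 11200 * E"
  have 1: "runs \<rho> (Fork arg0 (Fork tail1 UnitC)) (VPair (enc_list enc_cand cs) ?dk)
      (VPair (enc_list enc_cand cs) (VPair ?dk VUnit)) 10"
    by (rule runs_straight) simp_all
  have "\<exists>a'. runs \<rho> (fold_prog (select_step z A)) (VPair (enc_list enc_cand cs) (VPair ?dk VUnit)) a'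
      (15 * (?B + 1) * (length cs + 1)) \<and> ?I cs a'"
  proof (rule runs_fold_prog[where I = ?I])
    show "?I [] (VPair ?dk VUnit)" by simp
  next
    fix seen c rest a assume split: "cs = seen @ c # rest" and "?I seen a"
    then obtain best where a: "a = VPair ?dk best" and best: "?best seen best" by blast
    have c: "distinct (fst c @ snd c)" "set (fst c) \<union> set (snd c) = X" "length (snd c) \<le> m"
      using cs[of c] split by auto
    obtain out where run: "runs \<rho> A (enc_instance (fst c) d k 0) out tA"
      and ans: "good_answer z (set (fst c)) F k 0 chk \<alpha> out"
      using A[of c] split by auto
    let ?v = "VPair (enc_cand c) a"
    let ?u = "VPair out ?v"
    have 2: "runs \<rho> (Fork (fst_of arg0) (Fork (fst_of arg1) (Fork (snd_of arg1) (NatC 0)))) ?v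
        (enc_instance (fst c) d k 0) 20"
      and 3: "runs \<rho> Skip ?v ?v 1"
      and 4: "runs \<rho> arg1 ?v ?dk 3"
      and 5: "runs \<rho> tail3 ?u best 5"
      by (rule runs_straight; simp add: enc_cand_def enc_instance_def a)+
    note 6 = runs_Fork[OF runs_Seq[OF 2 run] 3]
    show "\<exists>a'. runs \<rho> (select_step z A) ?v a' ?B \<and> ?I (seen @ [c]) a'"
    proof (cases "feas c")
      case False
      then have out: "out = VUnit" using ans by (auto simp: good_answer_def feas_def)
      have "runs \<rho> (Seq arg0 (Op IsPair)) ?u (VBool False) 3"
        by (rule runs_straight) (simp_all add: out)
      then have 7: "runs \<rho> (If (Seq arg0 (Op IsPair)) (Seq (Fork (Seq (snd_of arg0) (cost_prog z)) Skip) update_prog) tail3)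
          ?u best (1 + 3 + 5)"
        by (rule runs_If) (use 5 in simp_all)
      have "runs \<rho> (select_step z A) ?v (VPair ?dk best) ?B"
        unfolding select_step_def
        by (rule runs_conv[OF runs_Fork[OF 4 runs_Seq[OF 6 7]]]) (use E in simp_all)
      moreover have "?best (seen @ [c]) best" using best False by auto
      ultimately show ?thesis by blast
    next
      case True
      then obtain x0 xss fs where out: "out = enc_solution x0 xss fs"
        and d: "distinct x0" "\<forall>ys\<in>set xss. distinct ys"
        and feasc: "feasible (set (fst c)) F k 0 chk (set x0) (map set xss) fs"
        and le: "cost z (map set xss) fs \<le> \<alpha> * opt z (set (fst c)) F k 0 chk"
        using ans unfolding good_answer_def feas_def by auto
      define C where "C = cost z (map set xss) fs"
      have len: "length xss = length fs" "length fs = k" using feasc by (auto simp: feasible_def)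
      have fX: "finite X" using c(2) by auto
      have "distinct ys \<and> length ys \<le> n" if ys: "ys \<in> set xss" for ys
      proof -
        have "set ys \<subseteq> set (fst c)"
          using feasc ys by (auto simp: feasible_def is_partition_def)
        then have "card (set ys) \<le> card X" using c(2) fX by (intro card_mono) auto
        then show ?thesis using d(2) ys n by (auto simp: distinct_card)
      qed
      then have "runs \<rho> (cost_prog z) (VPair (enc_list enc_pts xss) (enc_pts fs)) (VReal C)
          (11000 * ((n + 1) * (length fs + 1)))"
        unfolding C_def by (intro runs_cost_prog) (use z len in auto)
      then have 7: "runs \<rho> (cost_prog z) (VPair (enc_list enc_pts xss) (enc_pts fs)) (VReal C) (11000 * E)"
        by (simp add: len E_def)
      have 8: "runs \<rho> (Seq arg0 (Op IsPair)) ?u (VBool True) 3"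
        and 9: "runs \<rho> (snd_of arg0) ?u (VPair (enc_list enc_pts xss) (enc_pts fs)) 3"
        and 10: "runs \<rho> Skip ?u ?u 1"
        by (rule runs_straight; simp add: out enc_solution_def)+
      define keep where "keep \<longleftrightarrow> (\<exists>C' s. best = VPair (VReal C') s \<and> C' < C)"
      define best' where "best' = (if keep then best else VPair (VReal C) (enc_solution (snd c) xss fs))"
      have bc: "best = VUnit \<or> (\<exists>C' s. best = VPair (VReal C') s)" using best by blast
      have 11: "runs \<rho> update_prog (VPair (VReal C) ?u) best' 80"
        by (rule runs_straight)
          (use bc in \<open>auto simp: update_prog_def best'_def keep_def a out enc_cand_def enc_solution_def\<close>)
      have 12: "runs \<rho> (If (Seq arg0 (Op IsPair)) (Seq (Fork (Seq (snd_of arg0) (cost_prog z)) Skip) update_prog) tail3)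
          ?u best' (1 + 3 + (1 + (1 + (1 + 3 + 11000 * E) + 1) + 80))"
        by (rule runs_If[OF 8]) (use runs_Seq[OF runs_Fork[OF runs_Seq[OF 9 7] 10] 11] in simp_all)
      have "runs \<rho> (select_step z A) ?v (VPair ?dk best') ?B"
        unfolding select_step_def
        by (rule runs_conv[OF runs_Fork[OF 4 runs_Seq[OF 6 12]]]) (use E in simp_all)
      moreover have "?best (seen @ [c]) best'"
      proof (cases keep)
        case keep: True
        then have "best \<noteq> VUnit" by (auto simp: keep_def)
        then obtain y0 yss gs where y: "best = VPair (VReal (cost z (map set yss) gs)) (enc_solution y0 yss gs)"
          "?sol seen y0 yss gs" using best by blast
        then have "cost z (map set yss) gs < C" using keep by (auto simp: keep_def)
        then have "?sol (seen @ [c]) y0 yss gs" using y(2) le by (auto simp: C_def)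
        then have "\<exists>x0 xss fs. best' = VPair (VReal (cost z (map set xss) fs)) (enc_solution x0 xss fs) \<and>
            ?sol (seen @ [c]) x0 xss fs"
          using y(1) keep unfolding best'_def by auto
        then show ?thesis using True by auto
      next
        case nkeep: False
        have "feasible (set (fst c) \<union> set (snd c)) F k m chk (set (snd c)) (map set xss) fs"
          by (rule feasible_no_outliers_extend[OF feasc]) (use c in \<open>auto simp: distinct_card\<close>)
        then have f: "feasible X F k m chk (set (snd c)) (map set xss) fs" using c(2) by simp
        have old: "C \<le> \<alpha> * opt z (set (fst c')) F k 0 chk" if c': "c' \<in> set seen" "feas c'" for c'
        proof -
          obtain y0 yss gs where y: "best = VPair (VReal (cost z (map set yss) gs)) (enc_solution y0 yss gs)"
            "?sol seen y0 yss gs" using best c' by blast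
          then have "C \<le> cost z (map set yss) gs" using nkeep by (auto simp: keep_def)
          then show ?thesis using y(2) c' by force
        qed
        have "?sol (seen @ [c]) (snd c) xss fs"
          using c(1) d(2) f old le by (auto simp: C_def)
        then have "\<exists>x0 xss fs. best' = VPair (VReal (cost z (map set xss) fs)) (enc_solution x0 xss fs) \<and>
            ?sol (seen @ [c]) x0 xss fs"
          using nkeep unfolding best'_def C_def by auto
        then show ?thesis using True by auto
      qed
      ultimately show ?thesis by blast
    qed
  qed
  then obtain best where best: "?best cs best"
    and 2: "runs \<rho> (fold_prog (select_step z A)) (VPair (enc_list enc_cand cs) (VPair ?dk VUnit))
      (VPair ?dk best) (15 * (?B + 1) * (length cs + 1))" by blast
  have 3: "runs \<rho> tail1 (VPair ?dk best) best 1"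
    and 4: "runs \<rho> tail1 best (apply_op Snd best) 1"
    by (rule runs_straight; simp)+
  have "runs \<rho> (select_prog z A) (VPair (enc_list enc_cand cs) ?dk) (apply_op Snd best)
      (15 * (?B + 1) * (length cs + 1) + 20)"
    unfolding select_prog_def
    by (rule runs_conv[OF runs_Seq[OF runs_Seq[OF runs_Seq[OF 1 2] 3] 4]]) simp_all
  \<comment> \<open>\<open>Snd\<close> maps \<open>VUnit\<close> to \<open>VUnit\<close>, so
    stripping the stored cost also produces the right answer when no candidate is feasible.\<close>
  moreover have "if \<exists>c\<in>set cs. feas c then \<exists>x0 xss fs. apply_op Snd best = enc_solution x0 xss fs \<and> ?sol cs x0 xss fs
      else apply_op Snd best = VUnit"
    using best by (smt (verit, best) apply_op.simps(2) val.simps)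
  ultimately show ?thesis unfolding E_def feas_def by blast
qed

section \<open>The complete search\<close>

definition pool_size_prog :: "nat \<Rightarrow> prog" where
  "pool_size_prog L = Seq (Fork tail3 (op2 NAdd arg2 tail3)) (repeat_prog (op2 NAdd Skip (NatC L)))"

definition search_prog :: "nat \<Rightarrow> prog \<Rightarrow> nat \<Rightarrow> prog" where
  "search_prog z A L =
     Seq (Fork (Seq (Fork tail3 (Fork (pool_size_prog L) arg0)) pool_prog) Skip)
      (Seq (Fork (Seq (Fork (snd_of tail3) (Fork arg0 arg1)) candidates_prog)
             (Fork arg2 (fst_of tail3)))
        (select_prog z A))"

lemma runs_search_prog:
  fixes xs :: "'p::metric_space list"
  assumes z: "z \<in> {1, 2}" and \<epsilon>: "0 < \<epsilon>" "\<epsilon> \<le> 1" and L: "24 / \<epsilon>\<^sup>2 \<le> real L"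
    and chk: "cardinality_based chk" and \<alpha>: "0 \<le> \<alpha>" and xs: "distinct xs" and k: "1 \<le> k" and m: "1 \<le> m"
    and A: "\<And>ys. distinct ys \<Longrightarrow> set ys \<subseteq> set xs \<Longrightarrow>
      \<exists>out. runs \<rho> A (enc_instance ys d k 0) out tA \<and> good_answer z (set ys) F k 0 chk \<alpha> out"
  shows "\<exists>out. runs \<rho> (search_prog z A L) (enc_instance xs d k m) out
      ((30 * tA + 16000000 * (length xs + 1)) * (k + m + m * L + 1) ^ (2 * m + 3)) \<and>
    good_answer z (set xs) F k m chk (\<alpha> * (1 + \<epsilon>)) out"
proof -
  define G where "G = k + m + m * L"
  define H where "H = G + 1"
  define N where "N = length xs + 1"
  \<comment> \<open>H ^ (2 m) bounds the number of candidates, as \<open>Q\<close> is at most H ^ 2.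
    The three further factors pay for the factors \<open>Q\<close> and \<open>m + 1\<close> of the
    enumeration, and likewise for the (m + 1) (G + 1) ^ 2 of the pool.\<close>
  define S where "S = H ^ (2 * m + 3)"
  have G: "1 \<le> G" using k by (simp add: G_def)
  let ?v = "enc_instance xs d k m"
  have 1: "runs \<rho> (Fork tail3 (op2 NAdd arg2 tail3)) ?v (VPair (VNat m) (VNat (k + m))) 30"
    by (rule runs_straight) (simp_all add: enc_instance_def)
  \<comment> \<open>Naturals can be added but not multiplied on this machine, so
    \<open>m * L\<close> arises from \<open>m\<close> additions of the program constant
    \<open>L\<close>.\<close>
  have "\<exists>a'. runs \<rho> (repeat_prog (op2 NAdd Skip (NatC L))) (VPair (VNat m) (VNat (k + m))) a'
      (15 * (5 + 1) * (m + 1)) \<and> a' = VNat (k + m + m * L)"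
    by (rule runs_repeat_prog[where I = "\<lambda>i a. a = VNat (k + m + i * L)"])
      (auto intro!: exI runs_straight)
  then have 2: "runs \<rho> (repeat_prog (op2 NAdd Skip (NatC L))) (VPair (VNat m) (VNat (k + m))) (VNat G)
      (15 * (5 + 1) * (m + 1))" by (simp add: G_def)
  have 3: "runs \<rho> (pool_size_prog L) ?v (VNat G) (150 * (m + 1))"
    unfolding pool_size_prog_def by (rule runs_conv[OF runs_Seq[OF 1 2]]) simp_all
  obtain R where R: "set R \<subseteq> set xs" "length R \<le> m * G"
    and near: "\<forall>x\<in>set xs - set R. \<exists>M\<subseteq>set R. card M = m \<and>
       (\<forall>y\<in>M. \<exists>C\<subseteq>set xs. card C = G \<and> separated C (dist x y))"
    and 4: "runs \<rho> pool_prog (VPair (VNat m) (VPair (VNat G) (enc_pts xs))) (enc_pts R)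
      (7000000 * ((m + 1) * ((G + 1) ^ 2 * N)))"
    using runs_pool_prog[OF xs G, of \<rho> m] unfolding N_def by blast
  define Q where "Q = length R + 1"
  obtain cs where cs: "length cs \<le> Q ^ m"
    "\<forall>c\<in>set cs. distinct (fst c @ snd c) \<and> set (fst c) \<union> set (snd c) = set xs \<and> length (snd c) \<le> m"
    and all: "\<forall>Y\<subseteq>set R. card Y \<le> m \<longrightarrow> (\<exists>c\<in>set cs. set (snd c) = Y)"
    and 5: "runs \<rho> candidates_prog (VPair (VNat m) (VPair (enc_pts R) (enc_pts xs))) (enc_list enc_cand cs)
      (8000000 * (N * Q * Q ^ m * (m + 1)))"
    using runs_candidates_prog[OF xs R(1), of \<rho> m] unfolding N_def Q_def by blast
  have "\<exists>out. runs \<rho> A (enc_instance (fst c) d k 0) out tA \<and> good_answer z (set (fst c)) F k 0 chk \<alpha> out"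
    if "c \<in> set cs" for c
    by (rule A) (use cs(2) that in auto)
  then obtain out where
    6: "runs \<rho> (select_prog z A) (VPair (enc_list enc_cand cs) (VPair d (VNat k))) out
      (15 * (tA + 11200 * (N * (k + 1)) + 1) * (length cs + 1) + 20)"
    and out: "if \<exists>c\<in>set cs. \<exists>X0 Xs fs. feasible (set (fst c)) F k 0 chk X0 Xs fs
     then \<exists>x0 xss fs. out = enc_solution x0 xss fs \<and>
       distinct x0 \<and> (\<forall>ys\<in>set xss. distinct ys) \<and>
       feasible (set xs) F k m chk (set x0) (map set xss) fs \<and>
       (\<forall>c\<in>set cs. (\<exists>X0 Xs fs. feasible (set (fst c)) F k 0 chk X0 Xs fs) \<longrightarrow>
          cost z (map set xss) fs \<le> \<alpha> * opt z (set (fst c)) F k 0 chk)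
     else out = VUnit"
    using runs_select_prog[OF z card_length, of cs xs m \<rho> A d k tA F chk \<alpha>] cs(2) unfolding N_def
    by blast
  let ?u = "VPair (enc_pts R) ?v"
  have 7: "runs \<rho> tail3 ?v (VNat m) 5" and 8: "runs \<rho> arg0 ?v (enc_pts xs) 1"
    and 9: "runs \<rho> Skip ?v ?v 1"
    and 10: "runs \<rho> (Fork (snd_of tail3) (Fork arg0 arg1)) ?u (VPair (VNat m) (VPair (enc_pts R) (enc_pts xs))) 20"
    and 11: "runs \<rho> (Fork arg2 (fst_of tail3)) ?u (VPair d (VNat k)) 20"
    by (rule runs_straight; simp add: enc_instance_def)+
  note run = runs_Seq[OF runs_Fork[OF runs_Seq[OF runs_Fork[OF 7 runs_Fork[OF 3 8]] 4] 9]
      runs_Seq[OF runs_Fork[OF runs_Seq[OF 10 5] 11] 6]]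
  have H: "1 \<le> H" "k + 1 \<le> H" "m + 1 \<le> H" by (auto simp: H_def G_def)
  have NN: "1 \<le> N" by (simp add: N_def)
  have "Q \<le> m * G + 1" using R(2) by (simp add: Q_def)
  also have "\<dots> \<le> G * G + 1" using H(3) by (intro add_right_mono mult_right_mono) (auto simp: H_def)
  also have "\<dots> \<le> H * H" by (simp add: H_def)
  finally have Q: "Q \<le> H ^ 2" by (simp add: power2_eq_square)
  have Qm: "Q ^ m \<le> H ^ (2 * m)" using power_mono[OF Q, of m] by (simp add: power_mult)
  have S: "1 \<le> S" "H ^ (2 * m) \<le> S" "H ^ (2 * m) * H \<le> S" "H ^ 3 \<le> S"
    using H(1) power_increasing[of "2 * m" "2 * m + 3" H] power_increasing[of "Suc (2 * m)" "2 * m + 3" H]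
      power_increasing[of 3 "2 * m + 3" H]
    by (auto simp: S_def mult.commute)
  have t1: "(m + 1) * ((G + 1) ^ 2 * N) \<le> S * N"
  proof -
    have "(m + 1) * ((G + 1) ^ 2 * N) \<le> H * (H ^ 2 * N)"
      unfolding H_def[symmetric] by (rule mult_right_mono[OF H(3)]) simp
    also have "\<dots> = H ^ 3 * N" by (simp add: power2_eq_square power3_eq_cube)
    also have "\<dots> \<le> S * N" by (rule mult_right_mono[OF S(4)]) simp
    finally show ?thesis .
  qed
  have t2: "N * Q * Q ^ m * (m + 1) \<le> S * N"
  proof -
    have "N * Q * Q ^ m * (m + 1) \<le> N * H ^ 2 * H ^ (2 * m) * H"
      by (intro mult_mono Q Qm H(3)) auto
    also have "\<dots> = S * N" by (simp add: S_def power_add power2_eq_square power3_eq_cube)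
    finally show ?thesis .
  qed
  \<comment> \<open>This factor 2, together with the 15 of the fold, gives the 30 in front of
    \<open>tA\<close>.\<close>
  have len: "length cs + 1 \<le> 2 * H ^ (2 * m)"
    using cs(1) Qm one_le_power[OF H(1), of "2 * m"] by linarith
  have t3: "15 * (tA + 11200 * (N * (k + 1)) + 1) * (length cs + 1) \<le> 30 * (tA * S) + 337000 * (S * N)"
  proof -
    have "15 * (tA + 11200 * y + 1) \<le> 15 * tA + 168015 * y" if "1 \<le> y" for y
      using that by simp
    then have "15 * (tA + 11200 * (N * (k + 1)) + 1) \<le> 15 * tA + 168015 * (N * (k + 1))"
      using NN by simp
    also have "\<dots> \<le> 15 * tA + 168015 * (N * H)" using H(2) by (intro add_left_mono mult_left_mono) auto
    finally have "15 * (tA + 11200 * (N * (k + 1)) + 1) * (length cs + 1)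
        \<le> (15 * tA + 168015 * (N * H)) * (2 * H ^ (2 * m))"
      using len by (rule mult_mono) auto
    also have "\<dots> = 30 * (tA * H ^ (2 * m)) + 336030 * (N * (H ^ (2 * m) * H))"
      by (simp add: algebra_simps)
    also have "\<dots> \<le> 30 * (tA * S) + 336030 * (N * S)"
      using S by (intro add_mono mult_left_mono) auto
    finally show ?thesis by (simp add: mult.commute)
  qed
  have t4: "m + 1 \<le> S * N" "1 \<le> S * N"
  proof -
    have "(m + 1) * 1 \<le> (m + 1) * ((G + 1) ^ 2 * N)" using NN by (intro mult_left_mono) (auto simp: Suc_le_eq)
    from le_trans[OF this t1] show "m + 1 \<le> S * N" by simp
    show "1 \<le> S * N" using S(1) NN by simp
  qed
  have sum: "1 + (1 + (1 + (1 + 5 + (1 + 150 * (m + 1) + 1)) + 7000000 * t\<^sub>1) + 1) +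
      (1 + (1 + (1 + 20 + 8000000 * t\<^sub>2) + 20) + (t\<^sub>3 + 20)) \<le> 30 * u + 16000000 * w"
    if "t\<^sub>1 \<le> w" "t\<^sub>2 \<le> w" "t\<^sub>3 \<le> 30 * u + 337000 * w" "m + 1 \<le> w" "1 \<le> w" for t\<^sub>1 t\<^sub>2 t\<^sub>3 u w :: nat
    using that by simp
  have "runs \<rho> (search_prog z A L) ?v out (30 * (tA * S) + 16000000 * (S * N))"
    unfolding search_prog_def
    by (rule runs_conv[OF run refl sum[OF t1 t2 t3 t4]])
  then have "runs \<rho> (search_prog z A L) ?v out ((30 * tA + 16000000 * N) * S)"
    by (simp add: algebra_simps)
  moreover have "good_answer z (set xs) F k m chk (\<alpha> * (1 + \<epsilon>)) out"
  proof (cases "\<exists>X0 Xs fs. feasible (set xs) F k m chk X0 Xs fs")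
    case True
    \<comment> \<open>The exchange yields outliers \<open>Y\<close> within the pool, at most
      \<open>m\<close> of them, so some enumerated candidate sets aside exactly
      \<open>Y\<close>.\<close>
    have key: "\<exists>c\<in>set cs. \<exists>Ys. feasible (set (fst c)) F k 0 chk {} Ys fs \<and>
        cost z Ys fs \<le> (1 + \<epsilon>) * cost z Xs fs"
      if feas: "feasible (set xs) F k m chk X0 Xs fs" for X0 Xs fs
    proof -
      have "\<exists>M\<subseteq>set R. m \<le> card M \<and>
          (\<forall>y\<in>M. \<exists>C\<subseteq>set xs. k + m + m * L \<le> card C \<and> separated C (dist x y))"
        if "x \<in> set xs - set R" for x
        using near that unfolding G_def by (metis order_refl)
      from outlier_exchange[OF finite_set feas chk z \<epsilon> L R(1) this]
      obtain Y Ys where Y: "Y \<subseteq> set R" "card Y \<le> m" "feasible (set xs - Y) F k 0 chk {} Ys fs"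
        "cost z Ys fs \<le> (1 + \<epsilon>) * cost z Xs fs" by blast
      then obtain c where c: "c \<in> set cs" "set (snd c) = Y" using all by blast
      then have "set (fst c) = set xs - Y" using cs(2) by auto
      then show ?thesis using Y(3,4) c(1) by (intro bexI[of _ c] exI[of _ Ys]) simp_all
    qed
    from True key have ex: "\<exists>c\<in>set cs. \<exists>X0 Xs fs. feasible (set (fst c)) F k 0 chk X0 Xs fs" by blast
    from out[unfolded if_P[OF ex]] obtain x0 xss fs where sol: "out = enc_solution x0 xss fs" "distinct x0" "\<forall>ys\<in>set xss. distinct ys"
      "feasible (set xs) F k m chk (set x0) (map set xss) fs"
      and le: "\<And>c. c \<in> set cs \<Longrightarrow> \<exists>X0 Xs fs. feasible (set (fst c)) F k 0 chk X0 Xs fs \<Longrightarrow>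
          cost z (map set xss) fs \<le> \<alpha> * opt z (set (fst c)) F k 0 chk" by blast
    have bound: "cost z (map set xss) fs \<le> \<alpha> * (1 + \<epsilon>) * cost z Ys gs"
      if "feasible (set xs) F k m chk Y0 Ys gs" for Y0 Ys gs
    proof -
      obtain c Zs where c: "c \<in> set cs" "feasible (set (fst c)) F k 0 chk {} Zs gs"
        "cost z Zs gs \<le> (1 + \<epsilon>) * cost z Ys gs" using key[OF \<open>feasible _ _ _ _ _ Y0 Ys gs\<close>] by blast
      have "cost z (map set xss) fs \<le> \<alpha> * opt z (set (fst c)) F k 0 chk" using le c by blast
      also have "\<dots> \<le> \<alpha> * ((1 + \<epsilon>) * cost z Ys gs)"
        using opt_le_cost[OF c(2), of z] c(3) by (intro mult_left_mono \<alpha>) linarith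
      finally show ?thesis by (simp add: mult.assoc)
    qed
    \<comment> \<open>The optimum is an infimum, so \<open>bound\<close> is divided by the
      approximation factor and applied to every member of the set; the factor must be positive for
      this.\<close>
    have "cost z (map set xss) fs \<le> \<alpha> * (1 + \<epsilon>) * opt z (set xs) F k m chk"
    proof (cases "\<alpha> = 0")
      case True
      then show ?thesis using bound[OF sol(4)] by simp
    next
      case False
      then have pos: "0 < \<alpha> * (1 + \<epsilon>)" using \<alpha> \<epsilon> by simp
      have "cost z (map set xss) fs / (\<alpha> * (1 + \<epsilon>)) \<le> opt z (set xs) F k m chk"
        unfolding opt_def
        by (rule cInf_greatest) (use sol(4) bound pos in \<open>auto simp: pos_divide_le_eq mult.commute\<close>)
      then show ?thesis using pos by (simp add: pos_divide_le_eq mult.commute)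
    qed
    then show ?thesis using True sol unfolding good_answer_def by auto
  next
    case False
    \<comment> \<open>A solution for a candidate becomes one for the instance once the points set
      aside are declared outliers. So all candidates fail here.\<close>
    have "\<not> feasible (set (fst c)) F k 0 chk X0 Xs fs" if c: "c \<in> set cs" for c X0 Xs fs
    proof
      assume f: "feasible (set (fst c)) F k 0 chk X0 Xs fs"
      have "feasible (set (fst c) \<union> set (snd c)) F k m chk (set (snd c)) Xs fs"
        by (rule feasible_no_outliers_extend[OF f]) (use cs(2) c in \<open>auto simp: distinct_card\<close>)
      then show False using False cs(2) c by auto
    qed
    then have "out = VUnit" using out by (meson)
    then show ?thesis using False unfolding good_answer_def by auto
  qed
  ultimately show ?thesis unfolding N_def S_def H_def G_def by blast
qed

text \<open>For m = 0 the exponent in the bound on q vanishes, which leaves q = 1 and room for a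
  single call of \<open>A\<close>. The search with its constant factors would exceed that, hence the
  direct call.\<close>

definition outlier_prog :: "nat \<Rightarrow> prog \<Rightarrow> nat \<Rightarrow> prog" where
  "outlier_prog z A L = If (op2 NLess (NatC 0) tail3) (search_prog z A L) A"

lemma runs_outlier_prog:
  assumes "m = 0 \<Longrightarrow> runs \<rho> A (enc_instance xs d k m) out t"
    and "0 < m \<Longrightarrow> runs \<rho> (search_prog z A L) (enc_instance xs d k m) out t"
  shows "runs \<rho> (outlier_prog z A L) (enc_instance xs d k m) out (20 + t)"
proof -
  have 1: "runs \<rho> (op2 NLess (NatC 0) tail3) (enc_instance xs d k m) (VBool (0 < m)) 10"
    by (rule runs_straight) (simp_all add: enc_instance_def)
  show ?thesis
    unfolding outlier_prog_def by (rule runs_conv[OF runs_If[OF 1]]) (use assms in auto)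
qed

section \<open>Fitting accuracy and running time into the stated bounds\<close>

lemma good_answer_mono:
  "good_answer z X F k m chk \<alpha> out \<Longrightarrow> \<alpha> \<le> \<alpha>' \<Longrightarrow> good_answer z X F k m chk \<alpha>' out"
  unfolding good_answer_def
  by (smt (verit, best) mult_right_mono opt_nonneg)

text \<open>The base b = (k + m) / \<epsilon> is at least 2, so numerical constants can be absorbed
  as powers of b. The pool size satisfies H \<le> 32 (k + m) ^ 2 / \<epsilon> ^ 2 = 2 ^ 5 b ^ 2
  \<le> b ^ 7, and the total exponent 26 + 7 (2 m + 3) is below 100 m because m is at least
  1.\<close>

lemma pool_power_bound:
  fixes \<epsilon> :: real
  assumes "0 < \<epsilon>" "\<epsilon> \<le> 1" "1 \<le> k" "1 \<le> m"
  defines "L \<equiv> nat \<lceil>24 / \<epsilon>\<^sup>2\<rceil>"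
  shows "2 ^ 26 * real (k + m + m * L + 1) ^ (2 * m + 3) \<le> (real (k + m) / \<epsilon>) powr (100 * real m)"
proof -
  define b where "b = real (k + m) / \<epsilon>"
  have "real (k + m) / 1 \<le> b"
    unfolding b_def using assms by (intro divide_left_mono) auto
  then have km: "real (k + m) \<le> b" by simp
  then have b: "2 \<le> b" using assms by simp
  have e2: "1 \<le> 1 / \<epsilon>\<^sup>2" using assms by (simp add: power_le_one)
  have "0 \<le> 24 / \<epsilon>\<^sup>2" by simp
  then have "real L \<le> 24 / \<epsilon>\<^sup>2 + 1" unfolding L_def by linarith
  \<comment> \<open>Rounding up and the summand 2 give at most 27 / \<epsilon> ^ 2; 32 is the next
    power of two, to be absorbed as b ^ 5.\<close>
  then have L: "real L + 2 \<le> 32 * (1 / \<epsilon>\<^sup>2)" using e2 by simp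
  have "k + m + m * L + 1 \<le> (k + m) * (L + 2)" using assms(4) by (simp add: algebra_simps)
  then have "real (k + m + m * L + 1) \<le> real ((k + m) * (L + 2))" by (simp only: of_nat_le_iff)
  also have "\<dots> = real (k + m) * (real L + 2)" by (simp add: algebra_simps)
  also have "\<dots> \<le> real (k + m) * (32 * (1 / \<epsilon>\<^sup>2))" by (rule mult_left_mono[OF L]) simp
  also have "\<dots> = 32 * (1 * (real (k + m) * (1 / \<epsilon>\<^sup>2)))" by simp
  also have "\<dots> \<le> 32 * (real (k + m) * (real (k + m) * (1 / \<epsilon>\<^sup>2)))"
    using assms(3) by (intro mult_left_mono mult_right_mono) auto
  also have "\<dots> = 2 ^ 5 * b ^ 2" by (simp add: b_def power2_eq_square)
  also have "\<dots> \<le> b ^ 5 * b ^ 2" using b by (intro mult_right_mono power_mono) auto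
  finally have H: "real (k + m + m * L + 1) \<le> b ^ 7" by (simp add: power_add[symmetric])
  have "2 ^ 26 * real (k + m + m * L + 1) ^ (2 * m + 3) \<le> b ^ 26 * (b ^ 7) ^ (2 * m + 3)"
    using b by (intro mult_mono power_mono H) auto
  also have "\<dots> = b ^ (26 + 7 * (2 * m + 3))" by (simp add: power_add power_mult)
  also have "\<dots> \<le> b ^ (100 * m)" using b assms(4) by (intro power_increasing) auto
  also have "\<dots> = b powr (100 * real m)" using b by (simp add: powr_realpow[symmetric])
  finally show ?thesis unfolding b_def .
qed

text \<open>With \<open>n \<le> tA\<close>, all terms linear in the input size can be charged to the
  calls of the outlier-free algorithm. The constant is rounded up to a power of two so that it can
  be absorbed into a base of at least 2.\<close>

lemma outlier_prog_total_steps: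
  fixes n len tA S t :: nat
  assumes "t \<le> 20 + (30 * tA + 16000000 * (len + 1)) * S" "len \<le> n" "1 \<le> n" "n \<le> tA" "1 \<le> S"
  shows "n + t \<le> 2 ^ 26 * S * tA"
proof -
  have "len + 1 \<le> 2 * tA" using assms(2-4) by linarith
  then have "30 * tA + 16000000 * (len + 1) \<le> 32000030 * tA" by simp
  then have "(30 * tA + 16000000 * (len + 1)) * S \<le> 32000030 * tA * S" by (rule mult_right_mono) simp
  then have "t \<le> 20 + 32000030 * (tA * S)" using assms(1) by (simp only: mult.assoc)
  moreover have "tA * 1 \<le> tA * S" using assms(5) by (rule mult_left_mono) simp
  then have "n \<le> tA * S" using assms(4) by (metis le_trans mult.right_neutral)
  moreover have "a + b \<le> 2 ^ 26 * c" if "b \<le> 20 + 32000030 * c" "a \<le> c" "1 \<le> a" for a b c :: nat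
    using that by simp
  ultimately have "n + t \<le> 2 ^ 26 * (tA * S)" using assms(3) by blast
  then show ?thesis by (simp add: mult.assoc mult.commute[of tA])
qed

theorem theorem1:
  fixes z :: nat and \<beta> :: real
  assumes "z \<in> {1, 2}" and "\<beta> \<ge> 1"
  shows "\<exists>(c::real) (q :: nat \<Rightarrow> nat \<Rightarrow> real \<Rightarrow> nat). c > 0 \<and>
    (\<forall>k m \<epsilon>. k \<ge> 1 \<and> \<epsilon> > 0 \<longrightarrow>
       real (q k m \<epsilon>) \<le> (real (k + m) / min 1 \<epsilon>) powr (c * real m)) \<and>
    (\<forall>(\<rho> :: 'p::metric_space env) (P :: 'p problem) \<alpha> A C (T\<^sub>A :: nat \<Rightarrow> nat) (T\<^sub>C :: nat \<Rightarrow> nat).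
       clustering_problem P \<and> \<alpha> \<ge> 1 \<and>
       approx_alg \<rho> P z {0} \<alpha> A (\<lambda>n k m. real (T\<^sub>A n)) \<and>
       unconstrained_approx_alg \<rho> z \<beta> C (\<lambda>n. real (T\<^sub>C n)) \<longrightarrow>
       (\<forall>\<epsilon>>0. \<exists>B. approx_alg \<rho> P z UNIV (\<alpha> * (1 + \<epsilon>)) B
          (\<lambda>n k m. real (T\<^sub>C n) + real (q k m \<epsilon>) * real (T\<^sub>A n)
             + c * (real n * (real k + real m ^ (z + 1) * ln (real m) / \<epsilon> ^ z))
             + c * (real (q k m \<epsilon>) * real m ^ 2 * real (k + m) ^ 3))))"
proof -
  \<comment> \<open>Instead of the actual number of calls, \<open>q\<close> is the largest integer
    that the exponential bound permits; the slack absorbs the constant factors of the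
    search.\<close>
  define q :: "nat \<Rightarrow> nat \<Rightarrow> real \<Rightarrow> nat"
    where "q k m \<epsilon> = nat \<lfloor>(real (k + m) / min 1 \<epsilon>) powr (100 * real m)\<rfloor>" for k m \<epsilon>
  have q_le: "real (q k m \<epsilon>) \<le> (real (k + m) / min 1 \<epsilon>) powr (100 * real m)" for k m \<epsilon>
    unfolding q_def by (rule of_nat_floor) simp
  have alg: "approx_alg \<rho> P z UNIV (\<alpha> * (1 + \<epsilon>)) (outlier_prog z A (nat \<lceil>24 / (min 1 \<epsilon>)\<^sup>2\<rceil>))
          (\<lambda>n k m. real (T\<^sub>C n) + real (q k m \<epsilon>) * real (T\<^sub>A n)
             + 100 * (real n * (real k + real m ^ (z + 1) * ln (real m) / \<epsilon> ^ z))
             + 100 * (real (q k m \<epsilon>) * real m ^ 2 * real (k + m) ^ 3))"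
    if P: "clustering_problem P" and \<alpha>: "\<alpha> \<ge> 1"
      and A: "approx_alg \<rho> P z {0} \<alpha> A (\<lambda>n k m. real (T\<^sub>A n))" and \<epsilon>: "0 < \<epsilon>"
    for \<rho> :: "'p env" and P \<alpha> A \<epsilon> and T\<^sub>A T\<^sub>C :: "nat \<Rightarrow> nat"
    unfolding approx_alg_def Let_def good_answer_def[symmetric]
  proof (intro ballI allI impI)
    fix d and k m :: nat and xs :: "'p list" assume d: "d \<in> descr P" and asm: "distinct xs \<and> 1 \<le> k"
    define F chk where "F = locs P d" and "chk = check P d"
    define n where "n = inst_size (set xs) F k m"
    \<comment> \<open>The exchange requires an accuracy of at most 1. For a larger \<epsilon> the
      search runs with 1, and its better guarantee is weakened afterwards.\<close>
    define e where "e = min 1 \<epsilon>"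
    define L where "L = nat \<lceil>24 / e\<^sup>2\<rceil>"
    have e: "0 < e" "e \<le> 1" "e \<le> \<epsilon>" using \<epsilon> by (auto simp: e_def)
    have L: "24 / e\<^sup>2 \<le> real L" unfolding L_def by linarith
    have xs: "distinct xs" and k: "1 \<le> k" using asm by auto
    have n: "k \<le> n" "length xs \<le> n"
    proof -
      show "k \<le> n" by (simp add: n_def inst_size_def)
      have "card (set xs) \<le> card (if finite F then set xs \<union> F else set xs)"
        by (intro card_mono) auto
      then show "length xs \<le> n" using xs by (simp add: n_def inst_size_def distinct_card)
    qed
    have runA: "\<exists>out t. exec \<rho> A (enc_instance ys d j 0) out t \<and>
        (\<forall>N\<ge>inst_size (set ys) F j 0. inst_size (set ys) F j 0 + t \<le> T\<^sub>A N) \<and>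
        good_answer z (set ys) F j 0 chk \<alpha> out" if "distinct ys" "1 \<le> j" for ys j
      using A d that unfolding approx_alg_def Let_def good_answer_def F_def chk_def of_nat_le_iff by blast
    \<comment> \<open>\<open>T\<^sub>A\<close> need not be monotone, so its least value over all
      sizes from \<open>n\<close> on is used: it bounds every call on a sub-instance and is below
      \<open>T\<^sub>A N\<close> for each admissible \<open>N\<close>. As \<open>k\<close> and
      \<open>m\<close> both count towards the size, an outlier-free instance with
      \<open>k + m\<close> clusters has size exactly \<open>n\<close>, which ties this value to
      \<open>n\<close>.\<close>
    obtain N\<^sub>0 where N\<^sub>0: "n \<le> N\<^sub>0" "\<And>N. n \<le> N \<Longrightarrow> T\<^sub>A N\<^sub>0 \<le> T\<^sub>A N"
      using ex_has_least_nat[of "\<lambda>N. n \<le> N" n T\<^sub>A] by auto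
    \<comment> \<open>Reading the input is part of the running time, so \<open>T\<^sub>A\<close> is at least linear.\<close>
    have "inst_size (set xs) F (k + m) 0 = n" by (simp add: n_def inst_size_def)
    then have nT: "n \<le> T\<^sub>A N\<^sub>0" using runA[OF xs, of "k + m"] k N\<^sub>0(1) by fastforce
    have extra: "0 \<le> real m ^ (z + 1) * ln (real m) / \<epsilon> ^ z"
      using \<epsilon> by (cases "m = 0") auto
    \<comment> \<open>For positive \<open>m\<close> everything is charged to the calls of
      \<open>A\<close>; the summand with \<open>N\<close> and \<open>k\<close> pays for the test
      whether \<open>m\<close> is 0 when it is.\<close>
    have "\<exists>out t. exec \<rho> (outlier_prog z A L) (enc_instance xs d k m) out t \<and>
       (\<forall>N\<ge>n. real (n + t) \<le> real (q k m \<epsilon>) * real (T\<^sub>A N) + 100 * (real N * real k)) \<and>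
       good_answer z (set xs) F k m chk (\<alpha> * (1 + \<epsilon>)) out"
    proof (cases "m = 0")
      case True
      obtain out t where A': "exec \<rho> A (enc_instance xs d k m) out t"
        "\<forall>N\<ge>n. n + t \<le> T\<^sub>A N" "good_answer z (set xs) F k m chk \<alpha> out"
        using runA[OF xs k] True unfolding n_def by blast
      have "runs \<rho> (outlier_prog z A L) (enc_instance xs d k m) out (20 + t)"
        by (rule runs_outlier_prog) (use A'(1) True in \<open>auto simp: runs_def\<close>)
      then obtain t' where t': "t' \<le> 20 + t" "exec \<rho> (outlier_prog z A L) (enc_instance xs d k m) out t'"
        unfolding runs_def by blast
      \<comment> \<open>\<open>0 powr 0\<close> is 0, so a nonzero base is what makes
        \<open>q\<close> equal to 1 here.\<close>
      have "real (k + m) / min 1 \<epsilon> \<noteq> 0" using k \<epsilon> by simp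
      then have q: "q k m \<epsilon> = 1" using True by (simp add: q_def)
      have "real (n + t') \<le> real (q k m \<epsilon>) * real (T\<^sub>A N) + 100 * (real N * real k)" if N: "n \<le> N" for N
      proof -
        have "1 \<le> N * k" using N n k by simp
        moreover have "n + t \<le> T\<^sub>A N" using A'(2) N by blast
        ultimately have "n + t' \<le> T\<^sub>A N + 100 * (N * k)" using t'(1) by linarith
        then have "real (n + t') \<le> real (T\<^sub>A N + 100 * (N * k))" by (simp only: of_nat_le_iff)
        then show ?thesis by (simp add: q)
      qed
      moreover have "good_answer z (set xs) F k m chk (\<alpha> * (1 + \<epsilon>)) out"
        by (rule good_answer_mono[OF A'(3)]) (use \<alpha> \<epsilon> in simp)
      ultimately show ?thesis using t'(2) by blast
    next
      case False
      then have m: "1 \<le> m" by simp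
      have sub: "\<exists>out. runs \<rho> A (enc_instance ys d k 0) out (T\<^sub>A N\<^sub>0) \<and> good_answer z (set ys) F k 0 chk \<alpha> out"
        if ys: "distinct ys" "set ys \<subseteq> set xs" for ys
      proof -
        have "inst_size (set ys) F k 0 \<le> n"
          unfolding n_def inst_size_def using ys(2) by (auto intro!: card_mono add_mono trans_le_add1)
        then have "inst_size (set ys) F k 0 \<le> N\<^sub>0" using N\<^sub>0(1) by linarith
        moreover obtain out t where "exec \<rho> A (enc_instance ys d k 0) out t"
          "\<forall>N\<ge>inst_size (set ys) F k 0. inst_size (set ys) F k 0 + t \<le> T\<^sub>A N"
          "good_answer z (set ys) F k 0 chk \<alpha> out" using runA[OF ys(1) k] by blast
        ultimately show ?thesis unfolding runs_def by (meson add_leD2)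
      qed
      define S where "S = (k + m + m * L + 1) ^ (2 * m + 3)"
      obtain out where out: "good_answer z (set xs) F k m chk (\<alpha> * (1 + e)) out"
        and run: "runs \<rho> (search_prog z A L) (enc_instance xs d k m) out
          ((30 * T\<^sub>A N\<^sub>0 + 16000000 * (length xs + 1)) * S)"
        using runs_search_prog[OF assms(1) e(1,2) L _ _ xs k m sub] P d \<alpha>
        unfolding clustering_problem_def chk_def S_def by force
      have "runs \<rho> (outlier_prog z A L) (enc_instance xs d k m) out
          (20 + (30 * T\<^sub>A N\<^sub>0 + 16000000 * (length xs + 1)) * S)"
        by (rule runs_outlier_prog) (use run False in auto)
      then obtain t where t: "t \<le> 20 + (30 * T\<^sub>A N\<^sub>0 + 16000000 * (length xs + 1)) * S"
        "exec \<rho> (outlier_prog z A L) (enc_instance xs d k m) out t"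
        unfolding runs_def by blast
      have "n + t \<le> 2 ^ 26 * S * T\<^sub>A N\<^sub>0"
        by (rule outlier_prog_total_steps[OF t(1)]) (use n k nT in \<open>auto simp: S_def\<close>)
      moreover have "2 ^ 26 * S \<le> q k m \<epsilon>"
      proof -
        have "2 ^ 26 * real S \<le> (real (k + m) / min 1 \<epsilon>) powr (100 * real m)"
          using pool_power_bound[OF e(1,2) k m] by (simp add: S_def L_def e_def)
        then have "int (2 ^ 26 * S) \<le> \<lfloor>(real (k + m) / min 1 \<epsilon>) powr (100 * real m)\<rfloor>"
          unfolding le_floor_iff by simp
        then show ?thesis unfolding q_def by linarith
      qed
      ultimately have nt: "n + t \<le> q k m \<epsilon> * T\<^sub>A N\<^sub>0"
        by (meson le_trans mult_le_mono1)
      have "real (n + t) \<le> real (q k m \<epsilon>) * real (T\<^sub>A N) + 100 * (real N * real k)" if "n \<le> N" for N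
      proof -
        have "n + t \<le> q k m \<epsilon> * T\<^sub>A N" using nt N\<^sub>0(2)[OF that] by (meson le_trans mult_le_mono2)
        then have "real (n + t) \<le> real (q k m \<epsilon> * T\<^sub>A N)" by (simp only: of_nat_le_iff)
        then show ?thesis by (simp add: add_increasing2)
      qed
      moreover have "good_answer z (set xs) F k m chk (\<alpha> * (1 + \<epsilon>)) out"
        by (rule good_answer_mono[OF out]) (use \<alpha> e in simp)
      ultimately show ?thesis using t(2) by blast
    qed
    then obtain out t where res: "exec \<rho> (outlier_prog z A L) (enc_instance xs d k m) out t"
      "good_answer z (set xs) F k m chk (\<alpha> * (1 + \<epsilon>)) out"
      and time: "\<And>N. n \<le> N \<Longrightarrow> real (n + t) \<le> real (q k m \<epsilon>) * real (T\<^sub>A N) + 100 * (real N * real k)"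
      by blast
    have "real (n + t) \<le> real (T\<^sub>C N) + real (q k m \<epsilon>) * real (T\<^sub>A N)
             + 100 * (real N * (real k + real m ^ (z + 1) * ln (real m) / \<epsilon> ^ z))
             + 100 * (real (q k m \<epsilon>) * real m ^ 2 * real (k + m) ^ 3)" if "n \<le> N" for N
    proof -
      have "0 \<le> real N * (real m ^ (z + 1) * ln (real m) / \<epsilon> ^ z)"
        "0 \<le> real (q k m \<epsilon>) * real m ^ 2 * real (k + m) ^ 3" "0 \<le> real (T\<^sub>C N)"
        using mult_nonneg_nonneg[OF of_nat_0_le_iff extra] by simp_all
      then show ?thesis using time[OF that] unfolding distrib_left by linarith
    qed
    then show "\<exists>out t. exec \<rho> (outlier_prog z A (nat \<lceil>24 / (min 1 \<epsilon>)\<^sup>2\<rceil>)) (enc_instance xs d k m) out t \<and>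
        (\<forall>N\<ge>inst_size (set xs) (locs P d) k m. real (inst_size (set xs) (locs P d) k m + t) \<le>
             real (T\<^sub>C N) + real (q k m \<epsilon>) * real (T\<^sub>A N)
             + 100 * (real N * (real k + real m ^ (z + 1) * ln (real m) / \<epsilon> ^ z))
             + 100 * (real (q k m \<epsilon>) * real m ^ 2 * real (k + m) ^ 3)) \<and>
        good_answer z (set xs) (locs P d) k m (check P d) (\<alpha> * (1 + \<epsilon>)) out"
      using res unfolding n_def F_def chk_def L_def e_def by blast
  qed
  show ?thesis
  proof (intro exI[of _ 100] exI[of _ q] conjI allI impI)
    fix \<rho> :: "'p env" and P :: "'p problem" and \<alpha> \<epsilon> :: real and A C and T\<^sub>A T\<^sub>C :: "nat \<Rightarrow> nat"
    assume "clustering_problem P \<and> \<alpha> \<ge> 1 \<and> approx_alg \<rho> P z {0} \<alpha> A (\<lambda>n k m. real (T\<^sub>A n)) \<and>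
       unconstrained_approx_alg \<rho> z \<beta> C (\<lambda>n. real (T\<^sub>C n))" and "0 < \<epsilon>"
    then show "\<exists>B. approx_alg \<rho> P z UNIV (\<alpha> * (1 + \<epsilon>)) B
          (\<lambda>n k m. real (T\<^sub>C n) + real (q k m \<epsilon>) * real (T\<^sub>A n)
             + 100 * (real n * (real k + real m ^ (z + 1) * ln (real m) / \<epsilon> ^ z))
             + 100 * (real (q k m \<epsilon>) * real m ^ 2 * real (k + m) ^ 3))"
      using alg by blast
  qed (use q_le in simp_all)
qed

end
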